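(* Let $G$ be a unimodular locally compact second countable Hausdorff topological group, $\mathcal{H}$ a separable complex Hilbert space, $U\colon G\to\mathcal{U}(\mathcal{H})$ a square integrable (irreducible) projective representation, and let $\mu_G$ be the Haar measure on $G$ normalized in agreement with $U$. For $\hat T\in\mathcal{B}_2(\mathcal{H})$ and $g_1,g_2\in G$ put $\hat T(g_1,g_2):=U(g_1)\,\hat T\,U(g_2)^*$. Then: (1) For any $\hat A,\hat T\in\mathcal{B}_2(\mathcal{H})$, the map $G\times G\ni(g_1,g_2)\mapsto\langle\hat T(g_1,g_2),\hat A\rangle_{\mathcal{B}_2(\mathcal{H})}\in\mathbb{C}$ is a Borel function contained in $\mathrm{L}^2(G\times G,\mu_G\otimes\mu_G;\mathbb{C})$. (2) If $\hat T$ is nonzero and normalized (i.e. $\|\hat T\|_{\mathcal{B}_2(\mathcal{H})}=1$), the linear map $$\mathfrak{D}_{\hat T}\colon\mathcal{B}_2(\mathcal{H})\ni\hat A\mapsto\langle\hat T(\cdot,\cdot),\hat A\rangle_{\mathcal{B}_2(\mathcal{H})}\in\mathrm{L}^2(G\times G,\mu_G\otimes\mu_G;\mathbb{C})$$ is an isometry; namely, the family $\{\hat T(g_1,g_2)\colon(g_1,g_2)\in G\times G\}$ is a normalized tight frame in $\mathcal{B}_2(\mathcal{H})$, based on the measure space $(G\times G,\mu_G\otimes\mu_G)$. (3) For any $\hat A,\hat B,\hat S,\hat T\in\mathcal{B}_2(\mathcal{H})$ (with $\mathfrak{D}_{\hat T}\hat A:=\langle\hat T(\cdot,\cdot),\hat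 A\rangle_{\mathcal{B}_2(\mathcal{H})}$ for arbitrary $\hat T$), $$\int_{G\times G}\big(\mathfrak{D}_{\hat T}\hat A\big)(g_1,g_2)^*\,\big(\mathfrak{D}_{\hat S}\hat B\big)(g_1,g_2)\;\mathrm{d}\mu_G\otimes\mu_G(g_1,g_2)=\langle\hat A,\hat B\rangle_{\mathcal{B}_2(\mathcal{H})}\,\langle\hat S,\hat T\rangle_{\mathcal{B}_2(\mathcal{H})}.$$
   Context: Scalar products are linear in the second argument; $z^*$ denotes complex conjugation for numbers. $\mathcal{B}_2(\mathcal{H})$ is the Hilbert space of Hilbert-Schmidt operators with $\langle\hat A,\hat B\rangle_{\mathcal{B}_2(\mathcal{H})}=\mathrm{tr}(\hat A^*\hat B)$. Projective representation of $G$ in $\mathcal{H}$: a map $U\colon G\to\mathcal{U}(\mathcal{H})$ (unitary group) such that $g\mapsto\langle\phi,U(g)\psi\rangle$ is Borel for all $\phi,\psi\in\mathcal{H}$, $U(e)=I$, and $U(gh)=\mathtt{m}(g,h)U(g)U(h)$ for all $g,h\in G$, for some Borel function $\mathtt{m}\colon G\times G\to\mathbb{T}$ (the multiplier), $\mathbb{T}$ being the group of complex numbers of modulus one. An irreducible projective representation $U$ is square integrable if there exist nonzero $\psi,\phi\in\mathcal{H}$ with $g\mapsto\langle U(g)\psi,\phi\rangle$ in $\mathrm{L}^2(G,\mu_G;\mathbb{C})$. Known fact (Duflo-Moore): if $G$ is unimodular and $U$ is square integrable, then there is a number $d_U>0$, depending on the normalization of the Haar measure $\mu_G$, such that $\int_G\langle\phi_1,U(g)\psi_1\rangle\langle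 U(g)\psi_2,\phi_2\rangle\,\mathrm{d}\mu_G(g)=d_U^2\,\langle\phi_1,\phi_2\rangle\langle\psi_2,\psi_1\rangle$ for all $\phi_1,\phi_2,\psi_1,\psi_2\in\mathcal{H}$. The Haar measure $\mu_G$ is said to be normalized in agreement with $U$ if $d_U=1$. Normalized tight frame in a Hilbert space $\mathcal{S}$ based on a measure space $(X,\mu)$: a family $\{\psi_x\}_{x\in X}\subset\mathcal{S}$ such that, for every $\phi\in\mathcal{S}$, $x\mapsto\langle\psi_x,\phi\rangle$ is $\mu$-measurable and $\int_X|\langle\psi_x,\phi\rangle|^2\,\mathrm{d}\mu(x)=\|\phi\|^2$. *)

theory Defs
  imports "HOL-Analysis.Analysis"
begin

text \<open>The scalar product of a complex Hilbert space is taken to be linear in the second argument.\<close>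

class complex_inner = real_normed_vector +
  fixes scaleC :: "complex \<Rightarrow> 'a \<Rightarrow> 'a"
    and cinner :: "'a \<Rightarrow> 'a \<Rightarrow> complex"
  assumes scaleC_add_right: "scaleC c (x + y) = scaleC c x + scaleC c y"
    and scaleC_add_left: "scaleC (c + d) x = scaleC c x + scaleC d x"
    and scaleC_scaleC: "scaleC c (scaleC d x) = scaleC (c * d) x"
    and scaleR_scaleC: "scaleR r x = scaleC (complex_of_real r) x"
    and cinner_commute: "cinner x y = cnj (cinner y x)"
    and cinner_add_right: "cinner x (y + z) = cinner x y + cinner x z"
    and cinner_scaleC_right: "cinner x (scaleC c y) = c * cinner x y"
    and cinner_ge_zero: "0 \<le> Re (cinner x x)"
    and norm_eq_sqrt_cinner: "norm x = sqrt (Re (cinner x x))"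

class chilbert_space = complex_inner + complete_space

instantiation complex :: chilbert_space
begin

definition scaleC_complex :: "complex \<Rightarrow> complex \<Rightarrow> complex" where
  "scaleC_complex c x = c * x"

definition cinner_complex :: "complex \<Rightarrow> complex \<Rightarrow> complex" where
  "cinner_complex x y = cnj x * y"

instance
  by standard
    (auto simp: scaleC_complex_def cinner_complex_def algebra_simps scaleR_conv_of_real
      cmod_def power2_eq_square)

end

interpretation cvec: vector_space "scaleC :: complex \<Rightarrow> 'a \<Rightarrow> 'a::complex_inner"
  by standard
    (simp_all add: scaleC_add_right scaleC_add_left scaleC_scaleC
      scaleR_scaleC[of 1, simplified, symmetric])

definition bounded_clinear :: "('h::complex_inner \<Rightarrow> 'h) \<Rightarrow> bool" where
  "bounded_clinear A \<longleftrightarrow>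
     Vector_Spaces.linear scaleC scaleC A \<and> (\<exists>K. \<forall>x. norm (A x) \<le> K * norm x)"

definition cadjoint :: "('h::complex_inner \<Rightarrow> 'h) \<Rightarrow> 'h \<Rightarrow> 'h" where
  "cadjoint A = (THE B. \<forall>x y. cinner (B x) y = cinner x (A y))"

definition unitary_op :: "('h::complex_inner \<Rightarrow> 'h) \<Rightarrow> bool" where
  "unitary_op V \<longleftrightarrow>
     Vector_Spaces.linear scaleC scaleC V \<and> surj V \<and> (\<forall>x y. cinner (V x) (V y) = cinner x y)"

definition orthonormal_basis :: "'h::complex_inner set \<Rightarrow> bool" where
  "orthonormal_basis E \<longleftrightarrow>
     (\<forall>e\<in>E. \<forall>f\<in>E. cinner e f = (if e = f then 1 else 0)) \<and> closure (cvec.span E) = UNIV"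

text \<open>The sum defining the trace of a trace class operator does not depend on the orthonormal
  basis, nor does square summability of \<open>norm (A e)\<close>. The product of the adjoint of a
  Hilbert-Schmidt operator with a Hilbert-Schmidt operator is trace class.\<close>

definition ctrace :: "('h::complex_inner \<Rightarrow> 'h) \<Rightarrow> complex" where
  "ctrace A = (\<Sum>\<^sub>\<infinity>e\<in>(SOME E. orthonormal_basis E). cinner e (A e))"

definition hilbert_schmidt :: "('h::complex_inner \<Rightarrow> 'h) set" where
  "hilbert_schmidt =
     {A. bounded_clinear A \<and>
         (\<exists>E. orthonormal_basis E \<and> (\<lambda>e. (norm (A e))\<^sup>2) summable_on E)}"

definition hs_inner :: "('h::complex_inner \<Rightarrow> 'h) \<Rightarrow> ('h \<Rightarrow> 'h) \<Rightarrow> complex" where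
  "hs_inner A B = ctrace (cadjoint A \<circ> B)"

definition hs_norm :: "('h::complex_inner \<Rightarrow> 'h) \<Rightarrow> real" where
  "hs_norm A = sqrt (Re (hs_inner A A))"

definition L2_functions :: "'x measure \<Rightarrow> ('x \<Rightarrow> complex) set" where
  "L2_functions M = {f \<in> borel_measurable M. integrable M (\<lambda>x. (cmod (f x))\<^sup>2)}"

definition L2_norm :: "'x measure \<Rightarrow> ('x \<Rightarrow> complex) \<Rightarrow> real" where
  "L2_norm M f = sqrt (LINT x|M. (cmod (f x))\<^sup>2)"

text \<open>The Hilbert space is given by its carrier \<open>S\<close> and its scalar product \<open>ip\<close>, so that the
  notion applies to the set of Hilbert-Schmidt operators.\<close>

definition normalized_tight_frame ::
    "'v set \<Rightarrow> ('v \<Rightarrow> 'v \<Rightarrow> complex) \<Rightarrow> 'x measure \<Rightarrow> ('x \<Rightarrow> 'v) \<Rightarrow> bool" where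
  "normalized_tight_frame S ip M \<psi> \<longleftrightarrow>
     (\<forall>x\<in>space M. \<psi> x \<in> S) \<and>
     (\<forall>\<phi>\<in>S. (\<lambda>x. ip (\<psi> x) \<phi>) \<in> borel_measurable M \<and>
        (\<integral>\<^sup>+x. ennreal ((cmod (ip (\<psi> x) \<phi>))\<^sup>2) \<partial>M) = ennreal (Re (ip \<phi> \<phi>)))"

text \<open>The class \<^class>\<open>topological_group_add\<close> does not assume commutativity: the group
  operation, unit and inverse are written \<open>+\<close>, \<open>0\<close> and \<open>-\<close>. On a locally compact second
  countable Hausdorff group, where these definitions are used, a Borel measure that is finite on
  compact sets is automatically regular.\<close>

definition haar_measure :: "'g::{topological_group_add, t2_space} measure \<Rightarrow> bool" where
  "haar_measure \<mu> \<longleftrightarrow>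
     sets \<mu> = sets borel \<and>
     emeasure \<mu> UNIV \<noteq> 0 \<and>
     (\<forall>K. compact K \<longrightarrow> emeasure \<mu> K < \<infinity>) \<and>
     (\<forall>g. \<forall>A\<in>sets borel. emeasure \<mu> ((\<lambda>x. g + x) ` A) = emeasure \<mu> A)"

definition unimodular :: "'g::{topological_group_add, t2_space} itself \<Rightarrow> bool" where
  "unimodular _ \<longleftrightarrow>
     (\<forall>\<mu>::'g measure. haar_measure \<mu> \<longrightarrow>
        (\<forall>g. \<forall>A\<in>sets borel. emeasure \<mu> ((\<lambda>x. x + g) ` A) = emeasure \<mu> A))"

definition projective_representation ::
    "('g::{topological_group_add, t2_space} \<Rightarrow> 'h::chilbert_space \<Rightarrow> 'h) \<Rightarrow> bool" where
  "projective_representation U \<longleftrightarrow>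
     (\<forall>g. unitary_op (U g)) \<and>
     (\<forall>\<phi> \<psi>. (\<lambda>g. cinner \<phi> (U g \<psi>)) \<in> borel_measurable borel) \<and>
     U 0 = id \<and>
     (\<exists>m :: 'g \<times> 'g \<Rightarrow> complex.
        m \<in> borel_measurable borel \<and> (\<forall>p. cmod (m p) = 1) \<and>
        (\<forall>g h \<psi>. U (g + h) \<psi> = scaleC (m (g, h)) (U g (U h \<psi>))))"

definition irreducible_rep :: "('g \<Rightarrow> 'h::chilbert_space \<Rightarrow> 'h) \<Rightarrow> bool" where
  "irreducible_rep U \<longleftrightarrow>
     (\<forall>V. cvec.subspace V \<and> closed V \<and> (\<forall>g. U g ` V \<subseteq> V) \<longrightarrow> V = {0} \<or> V = UNIV)"

definition square_integrable_rep ::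
    "'g::{topological_group_add, t2_space} measure \<Rightarrow> ('g \<Rightarrow> 'h::chilbert_space \<Rightarrow> 'h) \<Rightarrow> bool" where
  "square_integrable_rep \<mu> U \<longleftrightarrow>
     projective_representation U \<and> irreducible_rep U \<and>
     (\<exists>\<psi> \<phi>. \<psi> \<noteq> 0 \<and> \<phi> \<noteq> 0 \<and> (\<lambda>g. cinner (U g \<psi>) \<phi>) \<in> L2_functions \<mu>)"

text \<open>The number \<open>d\<close> of the Duflo-Moore orthogonality relations. Taking \<open>\<phi>\<^sub>1 = \<phi>\<^sub>2\<close> and
  \<open>\<psi>\<^sub>1 = \<psi>\<^sub>2\<close> nonzero shows that it is unique on a nonzero space, and that the relations entail
  square integrability of all coefficient functions.\<close>

definition duflo_moore_number ::
    "'g measure \<Rightarrow> ('g \<Rightarrow> 'h::chilbert_space \<Rightarrow> 'h) \<Rightarrow> real \<Rightarrow> bool" where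
  "duflo_moore_number \<mu> U d \<longleftrightarrow> d > 0 \<and>
     (\<forall>\<phi>\<^sub>1 \<phi>\<^sub>2 \<psi>\<^sub>1 \<psi>\<^sub>2.
        (LINT g|\<mu>. cinner \<phi>\<^sub>1 (U g \<psi>\<^sub>1) * cinner (U g \<psi>\<^sub>2) \<phi>\<^sub>2) =
        (complex_of_real d)\<^sup>2 * (cinner \<phi>\<^sub>1 \<phi>\<^sub>2 * cinner \<psi>\<^sub>2 \<psi>\<^sub>1))"

definition normalized_in_agreement ::
    "'g measure \<Rightarrow> ('g \<Rightarrow> 'h::chilbert_space \<Rightarrow> 'h) \<Rightarrow> bool" where
  "normalized_in_agreement \<mu> U \<longleftrightarrow> duflo_moore_number \<mu> U 1"

definition op_orbit ::
    "('g \<Rightarrow> 'h::chilbert_space \<Rightarrow> 'h) \<Rightarrow> ('h \<Rightarrow> 'h) \<Rightarrow> 'g \<times> 'g \<Rightarrow> 'h \<Rightarrow> 'h" where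
  "op_orbit U T = (\<lambda>(g\<^sub>1, g\<^sub>2). U g\<^sub>1 \<circ> T \<circ> cadjoint (U g\<^sub>2))"

definition frame_transform ::
    "('g \<Rightarrow> 'h::chilbert_space \<Rightarrow> 'h) \<Rightarrow> ('h \<Rightarrow> 'h) \<Rightarrow> ('h \<Rightarrow> 'h) \<Rightarrow> 'g \<times> 'g \<Rightarrow> complex" where
  "frame_transform U T A = (\<lambda>p. hs_inner (op_orbit U T p) A)"

end

theory Submission
  imports Defs
begin

text \<open>
  The transform of \<open>A = |a\<rangle>\<langle>f|\<close> with respect to \<open>T = |t\<rangle>\<langle>e|\<close> factorises as
  \<open>\<langle>U(g\<^sub>1) t, a\<rangle> \<langle>f, U(g\<^sub>2) e\<rangle>\<close>, so for operators of rank one the claimed orthogonality relation is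
  the product of two instances of the Duflo-Moore relation. Expanding \<open>T = \<Sum>\<^sub>e |T e\<rangle>\<langle>e|\<close> and
  \<open>A = \<Sum>\<^sub>f |A f\<rangle>\<langle>f|\<close> in an orthonormal basis, the terms of the transform are pairwise orthogonal
  on \<open>G \<times> G\<close>, and Fatou's lemma bounds its norm by \<open>\<parallel>T\<parallel> \<parallel>A\<parallel>\<close> for all Hilbert-Schmidt \<open>T\<close> and \<open>A\<close>.
  Hence both sides of the orthogonality relation are continuous in each of their four arguments,
  and the relation extends from rank one operators.
\<close>

section \<open>Complex inner product spaces\<close>

text \<open>The L2 bound has to come before the relation. At a single point, Cauchy-Schwarz only
  shows that the transform is bounded, which gives no integrability when the Haar measure is
  infinite; without square integrability the left side could not be split or passed to a limit. Rank
  one operators are the right building blocks because their translates stay of rank one, so the two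
  group variables separate. A second obstacle is that the scalar product is a trace over one chosen
  basis, whereas the right factor U(g2) moves that basis to another one. Invariance of the
  Hilbert-Schmidt norm under translation therefore rests on basis independence, which is proved
  through adjoints and hence through Riesz representation. This invariance makes the finite rank
  approximations of the transform converge uniformly in (g1, g2), so measurability comes from them
  as well.\<close>

lemma cinner_add_left: "cinner (x + y) z = cinner x z + cinner y z"
  by (metis cinner_commute cinner_add_right complex_cnj_add)

lemma cinner_scaleC_left: "cinner (scaleC c x) y = cnj c * cinner x y"
  by (metis cinner_commute cinner_scaleC_right complex_cnj_mult)

lemma cinner_self: "cinner x x = complex_of_real ((norm x)\<^sup>2)"
proof (rule complex_eqI)
  show "Re (cinner x x) = Re (complex_of_real ((norm x)\<^sup>2))"
    by (simp add: norm_eq_sqrt_cinner cinner_ge_zero)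
  have "Im (cinner x x) = - Im (cinner x x)"
    by (subst cinner_commute) simp
  then show "Im (cinner x x) = Im (complex_of_real ((norm x)\<^sup>2))" by simp
qed

lemma norm_scaleC: "norm (scaleC c x) = cmod c * norm x"
proof -
  have "cinner (scaleC c x) (scaleC c x) = (c * cnj c) * cinner x x"
    unfolding cinner_scaleC_left cinner_scaleC_right by (simp only: ac_simps)
  then have "complex_of_real ((norm (scaleC c x))\<^sup>2) = complex_of_real ((cmod c * norm x)\<^sup>2)"
    unfolding cinner_self complex_norm_square[symmetric] by (simp add: power_mult_distrib)
  then show ?thesis
    by (metis norm_ge_zero mult_nonneg_nonneg of_real_eq_iff power2_eq_imp_eq)
qed

lemma norm_add_squared:
  "(norm (x + y))\<^sup>2 = (norm x)\<^sup>2 + (norm y)\<^sup>2 + 2 * Re (cinner x y)"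
proof -
  have "complex_of_real ((norm (x + y))\<^sup>2)
      = cinner x x + cinner y y + (cinner x y + cnj (cinner x y))"
    by (simp only: cinner_self[symmetric] cinner_add_left cinner_add_right cinner_commute[of y x])
      simp
  then have "Re (complex_of_real ((norm (x + y))\<^sup>2))
      = Re (cinner x x + cinner y y + (cinner x y + cnj (cinner x y)))"
    by simp
  then show ?thesis by (simp add: cinner_self)
qed

lemma cinner_Cauchy_Schwarz: "cmod (cinner x y) \<le> norm x * norm y"
proof (cases "x = 0")
  case True
  have "cinner 0 y = cinner 0 y + cinner 0 y"
    by (metis add_0 cinner_add_left)
  with True show ?thesis by simp
next
  case False
  let ?n = "(norm x)\<^sup>2" and ?c = "cinner x y"
  \<comment> \<open>This vector is \<open>(norm x)\<^sup>2\<close> times the component of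
    \<open>y\<close> orthogonal to \<open>x\<close>; scaling by the square avoids a
    division.\<close>
  have "0 \<le> (norm (scaleC (of_real ?n) y + scaleC (- ?c) x))\<^sup>2" by simp
  also have "\<dots> = ?n\<^sup>2 * (norm y)\<^sup>2 + (cmod ?c)\<^sup>2 * ?n
      + 2 * Re (of_real ?n * (- (?c * cnj ?c)))"
    unfolding norm_add_squared norm_scaleC cinner_scaleC_left cinner_scaleC_right
    by (simp add: cinner_commute[of y x] power_mult_distrib algebra_simps del: of_real_power)
  also have "\<dots> = ?n\<^sup>2 * (norm y)\<^sup>2 - ?n * (cmod ?c)\<^sup>2"
    by (simp only: complex_norm_square[symmetric] of_real_mult[symmetric] of_real_minus[symmetric]
        Re_complex_of_real) (simp add: algebra_simps)
  finally have "?n * (cmod ?c)\<^sup>2 \<le> ?n * (norm x * norm y)\<^sup>2"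
    by (simp add: power2_eq_square algebra_simps)
  with False have "(cmod ?c)\<^sup>2 \<le> (norm x * norm y)\<^sup>2"
    using mult_le_cancel_left_pos[of ?n] by simp
  then show ?thesis
    by (meson norm_ge_zero mult_nonneg_nonneg power2_le_imp_le)
qed

text \<open>Real bilinearity does not see the conjugation in the first argument, so facts on zero,
  differences and finite sums become available in both arguments.\<close>

interpretation cinner: bounded_bilinear "cinner :: 'a::complex_inner \<Rightarrow> 'a \<Rightarrow> complex"
proof
  show "\<exists>K. \<forall>a b. cmod (cinner a (b :: 'a)) \<le> norm a * norm b * K"
    by (rule exI[of _ 1]) (simp add: cinner_Cauchy_Schwarz)
qed (simp_all add: cinner_add_left cinner_add_right cinner_scaleC_left cinner_scaleC_right
    scaleR_scaleC[where 'a='a] scaleR_conv_of_real)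

lemma cinner_ext: "(\<And>y. cinner x y = cinner x' y) \<Longrightarrow> x = x'"
  by (metis cinner.diff_left cinner_self diff_self of_real_eq_0_iff power_eq_0_iff norm_eq_zero
      right_minus_eq)

lemma parallelogram_law:
  fixes x y :: "'a::complex_inner"
  shows "(norm (x - y))\<^sup>2 = 2 * (norm x)\<^sup>2 + 2 * (norm y)\<^sup>2 - (norm (x + y))\<^sup>2"
  using norm_add_squared[of x y] norm_add_squared[of x "- y"]
  by (simp add: cinner.minus_right)

section \<open>Adjoints of bounded operators\<close>

lemma clinearD:
  assumes "Vector_Spaces.linear scaleC scaleC A"
  shows "A (x + y) = A x + A y" "A (scaleC c x) = scaleC c (A x)" "A 0 = 0"
    "A (x - y) = A x - A y" "A (sum g F) = (\<Sum>i\<in>F. A (g i))"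
proof -
  interpret Vector_Spaces.linear scaleC scaleC A by fact
  show "A (x + y) = A x + A y" "A (scaleC c x) = scaleC c (A x)" "A 0 = 0"
    "A (x - y) = A x - A y" "A (sum g F) = (\<Sum>i\<in>F. A (g i))"
    by (fact add scale zero diff sum)+
qed

lemma clinearI:
  fixes A :: "'a::complex_inner \<Rightarrow> 'b::complex_inner"
  assumes "\<And>x y. A (x + y) = A x + A y" "\<And>c x. A (scaleC c x) = scaleC c (A x)"
  shows "Vector_Spaces.linear scaleC scaleC A"
  using assms by unfold_locales auto

lemma bounded_clinearI:
  fixes A :: "'a::complex_inner \<Rightarrow> 'a"
  assumes "\<And>x y. A (x + y) = A x + A y" "\<And>c x. A (scaleC c x) = scaleC c (A x)"
    and "\<And>x. norm (A x) \<le> K * norm x"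
  shows "bounded_clinear A"
  unfolding bounded_clinear_def using clinearI[of A] assms by blast

lemma bounded_clinearD:
  assumes "bounded_clinear A"
  shows "A (x + y) = A x + A y" "A (scaleC c x) = scaleC c (A x)" "A 0 = 0"
    "A (x - y) = A x - A y" "A (sum g F) = (\<Sum>i\<in>F. A (g i))"
  by (rule clinearD; use assms in \<open>simp add: bounded_clinear_def\<close>)+

lemma bounded_clinear_bound:
  assumes "bounded_clinear A"
  obtains K where "K \<ge> 0" "\<And>x. norm (A x) \<le> K * norm x"
proof -
  obtain K where K: "\<And>x. norm (A x) \<le> K * norm x"
    using assms unfolding bounded_clinear_def by blast
  \<comment> \<open>The constant in the definition may be negative on the zero space, hence the
    maximum.\<close>
  have "norm (A x) \<le> max K 0 * norm x" for x
    by (rule order_trans[OF K]) (simp add: mult_right_mono)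
  then show thesis by (intro that[of "max K 0"]) auto
qed

text \<open>The representing vector minimises \<open>\<parallel>y\<parallel>\<^sup>2 - 2 Re (f y)\<close>; a minimising sequence is Cauchy by
  the parallelogram law.\<close>

lemma riesz_representation:
  fixes f :: "'a::chilbert_space \<Rightarrow> complex"
  assumes add: "\<And>x y. f (x + y) = f x + f y"
    and scale: "\<And>c x. f (scaleC c x) = c * f x"
    and bound: "\<And>x. cmod (f x) \<le> K * norm x"
  obtains z where "\<And>y. f y = cinner z y"
proof -
  have scaleR: "f (r *\<^sub>R x) = r *\<^sub>R f x" for r x
    by (simp add: scaleR_scaleC[where 'a='a] scale scaleR_conv_of_real)
  have bl: "bounded_linear f"
    by (rule bounded_linear_intro[of _ K]) (use add scaleR bound in \<open>auto simp: mult.commute\<close>)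
  define J where "J y = (norm y)\<^sup>2 - 2 * Re (f y)" for y
  \<comment> \<open>Completing the square: \<open>J y\<close> is at least
    \<open>(norm y - K)\<^sup>2 - K\<^sup>2\<close>.\<close>
  have J_lower: "J y \<ge> - K\<^sup>2" for y
  proof -
    have "Re (f y) \<le> K * norm y"
      using bound[of y] complex_Re_le_cmod[of "f y"] by linarith
    moreover have "0 \<le> (norm y - K)\<^sup>2" by simp
    ultimately show ?thesis by (simp add: J_def power2_eq_square algebra_simps)
  qed
  define m where "m = Inf (range J)"
  have bdd: "bdd_below (range J)" using J_lower by (meson bdd_belowI2)
  have m: "m \<le> J y" for y unfolding m_def using bdd by (simp add: cInf_lower)
  have "\<exists>y. J y < m + 1 / Suc n" for n
    using cInf_lessD[of "range J" "m + 1 / Suc n"] by (auto simp: m_def)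
  then obtain s where s: "\<And>n. J (s n) < m + 1 / Suc n" by metis
  \<comment> \<open>The midpoint of \<open>x\<close> and \<open>y\<close> also has \<open>J\<close>
    at least \<open>m\<close>, so two nearly minimal points are close to each other.\<close>
  have mid: "(norm (x - y))\<^sup>2 \<le> 2 * (J x - m) + 2 * (J y - m)" for x y
  proof -
    have "J ((1/2) *\<^sub>R (x + y)) = (norm (x + y))\<^sup>2 / 4 - Re (f x) - Re (f y)"
      unfolding J_def scaleR add by (simp add: power2_eq_square add_divide_distrib)
    with m[of "(1/2) *\<^sub>R (x + y)"] show ?thesis
      unfolding parallelogram_law by (simp add: J_def)
  qed
  have "Cauchy s"
  proof (rule metric_CauchyI)
    fix e :: real assume "e > 0"
    then obtain N where N: "1 / Suc N < e\<^sup>2 / 4"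
      using nat_approx_posE[of "e\<^sup>2 / 4"] by auto
    have less: "J (s n) - m < e\<^sup>2 / 4" if "n \<ge> N" for n
    proof -
      have "1 / Suc n \<le> 1 / Suc N" using that by (simp add: frac_le)
      with s[of n] N show ?thesis by linarith
    qed
    have "dist (s i) (s j) < e" if "i \<ge> N" "j \<ge> N" for i j
    proof -
      have "(norm (s i - s j))\<^sup>2 < e\<^sup>2"
        using mid[of "s i" "s j"] less[OF that(1)] less[OF that(2)] by argo
      with \<open>e > 0\<close> show ?thesis by (simp add: dist_norm power2_less_imp_less)
    qed
    then show "\<exists>N. \<forall>i\<ge>N. \<forall>j\<ge>N. dist (s i) (s j) < e" by blast
  qed
  then obtain z where z: "s \<longlonglongrightarrow> z" using Cauchy_convergent convergent_def by blast
  have "(\<lambda>n. J (s n)) \<longlonglongrightarrow> J z"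
    unfolding J_def by (intro tendsto_intros z bounded_linear.tendsto[OF bl])
  moreover have "(\<lambda>n. m + 1 / Suc n) \<longlonglongrightarrow> m + 0"
    by (intro tendsto_intros LIMSEQ_Suc[OF lim_1_over_n])
  ultimately have Jz: "J z \<le> m"
    using s by (intro LIMSEQ_le[of "\<lambda>n. J (s n)"]) (auto intro: less_imp_le)
  \<comment> \<open>First variation at the minimiser: \<open>z\<close> is compared with z + t y and
    the inequality is divided by t. Letting t tend to 0 gives \<open>Re0\<close>; replacing y by - y
    and then by i y turns this into equality of real and of imaginary parts.\<close>
  have Re_le: "2 * Re (f y - cinner z y) \<le> t * (norm y)\<^sup>2" if "t > 0" for y t
  proof -
    have "J z \<le> J (z + t *\<^sub>R y)" using Jz m by (rule order_trans)
    then have "t * (2 * Re (f y - cinner z y)) \<le> t * (t * (norm y)\<^sup>2)"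
      unfolding J_def norm_add_squared add scaleR cinner.scaleR_right
      by (simp add: power2_eq_square algebra_simps)
    with \<open>t > 0\<close> show ?thesis by simp
  qed
  have Re0: "Re (f y - cinner z y) \<le> 0" for y
  proof (rule field_le_epsilon)
    fix e :: real assume "e > 0"
    show "Re (f y - cinner z y) \<le> 0 + e"
    proof (cases "y = 0")
      case True
      with scaleR[of 0 0] show ?thesis using \<open>e > 0\<close> by (simp add: cinner.zero_right)
    next
      case False
      then have "e / (norm y)\<^sup>2 * (norm y)\<^sup>2 = e" by simp
      with Re_le[of "e / (norm y)\<^sup>2" y] \<open>e > 0\<close> False
      have "2 * Re (f y - cinner z y) \<le> e" by (simp del: minus_complex.simps)
      with \<open>e > 0\<close> show ?thesis by linarith
    qed
  qed
  have neg: "f (- y) = - f y" for y using scaleR[of "- 1" y] by simp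
  have Re_eq: "Re (f y) = Re (cinner z y)" for y
    using Re0[of y] Re0[of "- y"] unfolding neg cinner.minus_right by simp
  have "f y = cinner z y" for y
  proof (rule complex_eqI)
    show "Im (f y) = Im (cinner z y)"
      using Re_eq[of "scaleC \<i> y"] unfolding scale cinner_scaleC_right by simp
  qed (rule Re_eq)
  then show thesis by (rule that)
qed

text \<open>Scalar products separate points, so the definite description has at most one candidate
  and exhibiting a formal adjoint settles it.\<close>

lemma cadjointI:
  assumes "\<And>x y. cinner (B x) y = cinner x (A y)"
  shows "cadjoint A = B"
  unfolding cadjoint_def
proof (rule the_equality)
  fix C assume "\<forall>x y. cinner (C x) y = cinner x (A y)"
  show "C = B"
  proof (rule ext, rule cinner_ext)
    show "cinner (C x) y = cinner (B x) y" for x y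
      using assms[of x y] \<open>\<forall>x y. cinner (C x) y = cinner x (A y)\<close> by simp
  qed
qed (use assms in blast)

lemma cinner_cadjoint_left:
  fixes A :: "'a::chilbert_space \<Rightarrow> 'a"
  assumes A: "bounded_clinear A"
  shows "cinner (cadjoint A x) y = cinner x (A y)"
proof -
  obtain K where K: "K \<ge> 0" "\<And>x. norm (A x) \<le> K * norm x"
    using bounded_clinear_bound[OF A] by blast
  \<comment> \<open>For fixed \<open>x\<close> the right side is a bounded linear functional of
    \<open>y\<close>; completeness enters here through \<open>riesz_representation\<close>.\<close>
  have "\<exists>z. \<forall>y. cinner x (A y) = cinner z y" for x
  proof -
    have "cmod (cinner x (A y)) \<le> (norm x * K) * norm y" for y
      using order_trans[OF cinner_Cauchy_Schwarz mult_left_mono[OF K(2) norm_ge_zero]]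
      by (simp add: mult.assoc)
    then show ?thesis
      by (rule riesz_representation[rotated 2, of "\<lambda>y. cinner x (A y)"])
        (auto simp: bounded_clinearD[OF A] cinner_add_right cinner_scaleC_right)
  qed
  then obtain B where B: "\<And>x y. cinner x (A y) = cinner (B x) y" by metis
  with cadjointI[of B A] show ?thesis by simp
qed

lemma cinner_cadjoint_right:
  fixes A :: "'a::chilbert_space \<Rightarrow> 'a"
  assumes "bounded_clinear A"
  shows "cinner x (cadjoint A y) = cinner (A x) y"
  using cinner_cadjoint_left[OF assms, of y x]
  by (subst (1 2) cinner_commute) simp

lemma bounded_clinear_cadjoint:
  fixes A :: "'a::chilbert_space \<Rightarrow> 'a"
  assumes A: "bounded_clinear A"
  shows "bounded_clinear (cadjoint A)"
proof -
  obtain K where K: "K \<ge> 0" "\<And>x. norm (A x) \<le> K * norm x"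
    using bounded_clinear_bound[OF A] by blast
  show ?thesis
  proof (rule bounded_clinearI)
    show "cadjoint A (x + y) = cadjoint A x + cadjoint A y" for x y
      by (rule cinner_ext) (simp add: cinner_cadjoint_left[OF A] cinner_add_left)
    show "cadjoint A (scaleC c x) = scaleC c (cadjoint A x)" for c x
      by (rule cinner_ext) (simp add: cinner_cadjoint_left[OF A] cinner_scaleC_left)
    show "norm (cadjoint A x) \<le> K * norm x" for x
    proof -
      let ?y = "cadjoint A x"
      \<comment> \<open>The square is estimated so that one factor \<open>norm ?y\<close> can be
        cancelled, unless it is 0.\<close>
      have "(norm ?y)\<^sup>2 = cmod (cinner x (A ?y))"
        unfolding cinner_cadjoint_left[OF A, symmetric] cinner_self norm_of_real by simp
      also have "\<dots> \<le> norm x * (K * norm ?y)"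
        by (rule order_trans[OF cinner_Cauchy_Schwarz mult_left_mono[OF K(2) norm_ge_zero]])
      finally have "norm ?y * norm ?y \<le> (K * norm x) * norm ?y"
        by (simp add: power2_eq_square ac_simps)
      then show ?thesis using K(1)
        by (cases "norm ?y = 0") auto
    qed
  qed
qed

lemma cadjoint_cadjoint:
  fixes A :: "'a::chilbert_space \<Rightarrow> 'a"
  assumes "bounded_clinear A"
  shows "cadjoint (cadjoint A) = A"
  by (rule cadjointI) (simp add: cinner_cadjoint_right[OF assms])

lemma unitary_opD:
  assumes "unitary_op V"
  shows "cinner (V x) (V y) = cinner x y" "norm (V x) = norm x" "bounded_clinear V" "surj V"
    "cadjoint V (V x) = x" "V (cadjoint V x) = x"
proof -
  show inner: "cinner (V x) (V y) = cinner x y" for x y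
    using assms by (simp add: unitary_op_def)
  show surj: "surj V" using assms by (simp add: unitary_op_def)
  show norm: "norm (V x) = norm x" for x
    using inner[of x x] by (simp add: norm_eq_sqrt_cinner)
  show "bounded_clinear V"
    unfolding bounded_clinear_def
    using assms norm by (auto simp: unitary_op_def intro!: exI[of _ 1])
  have inj: "inj V"
  proof (rule injI)
    fix a b assume "V a = V b"
    then show "a = b" by (metis cinner_ext inner)
  qed
  \<comment> \<open>Surjectivity lets \<open>x\<close> be written as \<open>V (inv V x)\<close>;
    preservation of the scalar product then is the adjoint identity.\<close>
  have "cadjoint V = inv V"
    by (rule cadjointI) (metis inner surj surj_f_inv_f)
  then show "cadjoint V (V x) = x" "V (cadjoint V x) = x"
    by (simp_all add: inj surj surj_f_inv_f)
qed

section \<open>Orthonormal bases and Hilbert-Schmidt operators\<close>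

text \<open>The sum is the projection \<open>p\<close> of \<open>x\<close> on the span of
  \<open>F\<close>: it has the same coefficients as \<open>x\<close> on \<open>F\<close>, so
  \<open>x - p\<close> is orthogonal to \<open>p\<close> and Pythagoras applies.\<close>

lemma orthonormal_residual:
  fixes x :: "'a::complex_inner"
  assumes fin: "finite F"
    and on: "\<And>e f. e \<in> F \<Longrightarrow> f \<in> F \<Longrightarrow> cinner e f = (if e = f then 1 else 0)"
  shows "(norm (x - (\<Sum>e\<in>F. scaleC (cinner e x) e)))\<^sup>2 = (norm x)\<^sup>2 - (\<Sum>e\<in>F. (cmod (cinner e x))\<^sup>2)"
proof -
  define p where "p = (\<Sum>e\<in>F. scaleC (cinner e x) e)"
  have inner_p: "cinner p y = (\<Sum>e\<in>F. cnj (cinner e x) * cinner e y)" for y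
    by (simp add: p_def cinner.sum_left cinner_scaleC_left)
  have inner_e: "cinner e p = cinner e x" if "e \<in> F" for e
  proof -
    have "cinner e p = (\<Sum>f\<in>F. if e = f then cinner f x else 0)"
      unfolding p_def cinner.sum_right cinner_scaleC_right
      by (rule sum.cong) (simp_all add: on that)
    then show ?thesis using fin that by simp
  qed
  have px: "cinner p p = cinner p x"
    unfolding inner_p[of p] inner_p[of x] by (rule sum.cong) (simp_all add: inner_e)
  have orth: "cinner p (x - p) = 0" by (simp add: cinner.diff_right px)
  have "cinner p p = complex_of_real (\<Sum>e\<in>F. (cmod (cinner e x))\<^sup>2)"
    unfolding px unfolding inner_p of_real_sum complex_norm_square by (simp only: mult.commute)
  then have norm_p: "(norm p)\<^sup>2 = (\<Sum>e\<in>F. (cmod (cinner e x))\<^sup>2)"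
    unfolding cinner_self of_real_eq_iff .
  have "(norm x)\<^sup>2 = (norm p)\<^sup>2 + (norm (x - p))\<^sup>2"
    using norm_add_squared[of p "x - p"] orth by simp
  then show ?thesis by (simp add: norm_p flip: p_def)
qed

lemma bessel_inequality:
  fixes x :: "'a::complex_inner"
  assumes "finite F" "\<And>e f. e \<in> F \<Longrightarrow> f \<in> F \<Longrightarrow> cinner e f = (if e = f then 1 else 0)"
  shows "(\<Sum>e\<in>F. (cmod (cinner e x))\<^sup>2) \<le> (norm x)\<^sup>2"
  using orthonormal_residual[OF assms, of x]
    zero_le_power2[of "norm (x - (\<Sum>e\<in>F. scaleC (cinner e x) e))"]
  by linarith

lemma orthonormal_basis_cinner:
  "orthonormal_basis E \<Longrightarrow> e \<in> E \<Longrightarrow> f \<in> E \<Longrightarrow> cinner e f = (if e = f then 1 else 0)"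
  unfolding orthonormal_basis_def by blast

text \<open>Bessel gives summability and one inequality. For the other, density supplies a finite
  combination \<open>y\<close> near \<open>x\<close>; subtracting \<open>y\<close> does not change
  the residual over the finite set \<open>F\<close> spanning it, so this residual is at most
  \<open>norm (x - y)\<close>.\<close>

lemma parseval:
  fixes x :: "'a::complex_inner"
  assumes E: "orthonormal_basis E"
  shows "((\<lambda>e. (cmod (cinner e x))\<^sup>2) has_sum (norm x)\<^sup>2) E"
proof -
  let ?f = "\<lambda>e. (cmod (cinner e x))\<^sup>2"
  have on: "cinner e f = (if e = f then 1 else 0)" if "F \<subseteq> E" "e \<in> F" "f \<in> F" for e f F
    using orthonormal_basis_cinner[OF E] that by blast
  have bessel: "sum ?f F \<le> (norm x)\<^sup>2" if "finite F" "F \<subseteq> E" for F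
    using that by (intro bessel_inequality on)
  have summable: "?f summable_on E"
    by (rule nonneg_bdd_above_summable_on) (use bessel in \<open>auto intro!: bdd_aboveI2\<close>)
  have "(norm x)\<^sup>2 \<le> infsum ?f E"
  proof (rule field_le_epsilon)
    fix \<epsilon> :: real assume "\<epsilon> > 0"
    have "x \<in> closure (cvec.span E)" using E by (simp add: orthonormal_basis_def)
    then obtain y where y: "y \<in> cvec.span E" "dist y x < sqrt \<epsilon>"
      using \<open>\<epsilon> > 0\<close> by (meson closure_approachable real_sqrt_gt_zero)
    then obtain F r where F: "finite F" "F \<subseteq> E" "y = (\<Sum>a\<in>F. scaleC (r a) a)"
      unfolding cvec.span_explicit by blast
    have r: "cinner e y = r e" if "e \<in> F" for e
    proof -
      have "cinner e y = (\<Sum>a\<in>F. if e = a then r a else 0)"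
        unfolding F(3) cinner.sum_right cinner_scaleC_right
        using on[OF F(2) that] by (intro sum.cong) simp_all
      then show ?thesis using F(1) that by simp
    qed
    have "(\<Sum>e\<in>F. scaleC (cinner e (x - y)) e)
        = (\<Sum>e\<in>F. scaleC (cinner e x) e - scaleC (r e) e)"
      by (rule sum.cong) (simp_all add: cinner.diff_right r cvec.scale_left_diff_distrib)
    then have proj: "(\<Sum>e\<in>F. scaleC (cinner e (x - y)) e) = (\<Sum>e\<in>F. scaleC (cinner e x) e) - y"
      by (simp add: sum_subtractf F(3))
    have "(norm x)\<^sup>2 - sum ?f F = (norm (x - (\<Sum>e\<in>F. scaleC (cinner e x) e)))\<^sup>2"
      by (rule orthonormal_residual[symmetric, OF F(1) on[OF F(2)]])
    also have "\<dots> = (norm ((x - y) - (\<Sum>e\<in>F. scaleC (cinner e (x - y)) e)))\<^sup>2"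
      by (simp add: proj)
    also have "\<dots> = (norm (x - y))\<^sup>2 - (\<Sum>e\<in>F. (cmod (cinner e (x - y)))\<^sup>2)"
      by (rule orthonormal_residual[OF F(1) on[OF F(2)]])
    also have "\<dots> \<le> (norm (x - y))\<^sup>2" by (simp add: sum_nonneg)
    also have "\<dots> \<le> \<epsilon>"
      using y(2) \<open>\<epsilon> > 0\<close> sqrt_ge_absD[of "norm (x - y)" \<epsilon>]
      by (simp add: dist_norm norm_minus_commute)
    finally have "(norm x)\<^sup>2 \<le> sum ?f F + \<epsilon>" by simp
    also have "sum ?f F \<le> infsum ?f E"
      by (rule finite_sum_le_infsum) (use summable F in auto)
    finally show "(norm x)\<^sup>2 \<le> infsum ?f E + \<epsilon>" by simp
  qed
  moreover have "infsum ?f E \<le> (norm x)\<^sup>2"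
    by (rule infsum_le_finite_sums) (use summable bessel in auto)
  ultimately show ?thesis using has_sum_infsum[OF summable] by simp
qed

text \<open>Applying this bound first to \<open>A\<close> and then to its adjoint shows that the sum of
  \<open>\<parallel>A e\<parallel>\<^sup>2\<close> does not depend on the basis.\<close>

lemma sum_norm_cadjoint_le:
  fixes A :: "'a::chilbert_space \<Rightarrow> 'a"
  assumes A: "bounded_clinear A" and E: "orthonormal_basis E" and E': "orthonormal_basis E'"
    and S: "((\<lambda>e. (norm (A e))\<^sup>2) has_sum S) E" and F: "finite F" "F \<subseteq> E'"
  shows "(\<Sum>f\<in>F. (norm (cadjoint A f))\<^sup>2) \<le> S"
proof (rule has_sum_mono)
  \<comment> \<open>Each \<open>(norm (cadjoint A f))\<^sup>2\<close> is expanded by Parseval in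
    \<open>E\<close>; after the adjoint is moved across, the terms at a fixed \<open>e\<close> form
    a Bessel sum for \<open>A e\<close>.\<close>
  show "((\<lambda>e. \<Sum>f\<in>F. (cmod (cinner e (cadjoint A f)))\<^sup>2) has_sum
      (\<Sum>f\<in>F. (norm (cadjoint A f))\<^sup>2)) E"
    using F(1)
  proof (induction F)
    case (insert f F)
    then show ?case using has_sum_add[OF parseval[OF E] insert.IH] by simp
  qed (simp add: has_sum_0)
  show "((\<lambda>e. (norm (A e))\<^sup>2) has_sum S) E" by (rule S)
  fix e
  have "(\<Sum>f\<in>F. (cmod (cinner e (cadjoint A f)))\<^sup>2) = (\<Sum>f\<in>F. (cmod (cinner f (A e)))\<^sup>2)"
    by (simp add: cinner_cadjoint_right[OF A] cinner_commute[of "A e"])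
  also have "\<dots> \<le> (norm (A e))\<^sup>2"
    using F by (intro bessel_inequality orthonormal_basis_cinner[OF E']) auto
  finally show "(\<Sum>f\<in>F. (cmod (cinner e (cadjoint A f)))\<^sup>2) \<le> (norm (A e))\<^sup>2" .
qed

lemma has_sum_norm_cadjoint:
  fixes A :: "'a::chilbert_space \<Rightarrow> 'a"
  assumes A: "bounded_clinear A" and E: "orthonormal_basis E" and E': "orthonormal_basis E'"
    and S: "((\<lambda>e. (norm (A e))\<^sup>2) has_sum S) E"
  obtains S' where "S' \<le> S" "((\<lambda>f. (norm (cadjoint A f))\<^sup>2) has_sum S') E'"
proof -
  note le = sum_norm_cadjoint_le[OF A E E' S]
  have summable: "(\<lambda>f. (norm (cadjoint A f))\<^sup>2) summable_on E'"
    by (rule nonneg_bdd_above_summable_on) (use le in \<open>auto intro!: bdd_aboveI2\<close>)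
  have "(\<Sum>\<^sub>\<infinity>f\<in>E'. (norm (cadjoint A f))\<^sup>2) \<le> S"
    by (rule infsum_le_finite_sums) (use summable le in auto)
  with has_sum_infsum[OF summable] show thesis using that by blast
qed

lemma has_sum_norm_basis_change:
  fixes A :: "'a::chilbert_space \<Rightarrow> 'a"
  assumes A: "bounded_clinear A" and E: "orthonormal_basis E" and E': "orthonormal_basis E'"
    and S: "((\<lambda>e. (norm (A e))\<^sup>2) has_sum S) E"
  shows "((\<lambda>e. (norm (A e))\<^sup>2) has_sum S) E'"
proof -
  have le: "\<exists>S'\<le>S. ((\<lambda>e. (norm (A e))\<^sup>2) has_sum S') E'"
    if E: "orthonormal_basis E" and E': "orthonormal_basis E'"
      and S: "((\<lambda>e. (norm (A e))\<^sup>2) has_sum S) E" for E E' S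
  proof -
    obtain S1 where S1: "S1 \<le> S" "((\<lambda>f. (norm (cadjoint A f))\<^sup>2) has_sum S1) E"
      using has_sum_norm_cadjoint[OF A E E S] .
    obtain S2 where "S2 \<le> S1" "((\<lambda>f. (norm (cadjoint (cadjoint A) f))\<^sup>2) has_sum S2) E'"
      using has_sum_norm_cadjoint[OF bounded_clinear_cadjoint[OF A] E E' S1(2)] .
    with S1(1) show ?thesis by (auto simp: cadjoint_cadjoint[OF A] intro: order_trans)
  qed
  \<comment> \<open>Going from \<open>E\<close> to \<open>E'\<close> and back yields
    \<open>S'' \<le> S' \<le> S\<close>, and uniqueness of the sum over \<open>E\<close> forces
    \<open>S'' = S\<close>.\<close>
  obtain S' where S': "S' \<le> S" "((\<lambda>e. (norm (A e))\<^sup>2) has_sum S') E'"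
    using le[OF E E' S] by blast
  obtain S'' where "S'' \<le> S'" "((\<lambda>e. (norm (A e))\<^sup>2) has_sum S'') E"
    using le[OF E' E S'(2)] by blast
  with S S' show ?thesis by (metis antisym has_sum_unique)
qed

section \<open>The Hilbert-Schmidt scalar product and norm\<close>

definition trace_basis :: "'a::complex_inner set" where
  "trace_basis = (SOME E. orthonormal_basis E)"

text \<open>Membership in \<open>hilbert_schmidt\<close> carries a witness basis, so any
  Hilbert-Schmidt operator justifies the choice made in \<open>ctrace\<close>.\<close>

lemma orthonormal_trace_basis:
  assumes "(A :: 'a::complex_inner \<Rightarrow> 'a) \<in> hilbert_schmidt"
  shows "orthonormal_basis (trace_basis :: 'a set)"
  unfolding trace_basis_def
  by (rule someI_ex) (use assms in \<open>auto simp: hilbert_schmidt_def\<close>)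

lemma hilbert_schmidt_bounded_clinear: "A \<in> hilbert_schmidt \<Longrightarrow> bounded_clinear A"
  by (simp add: hilbert_schmidt_def)

lemma hilbert_schmidtI:
  assumes "bounded_clinear A" "orthonormal_basis E" "((\<lambda>e. (norm (A e))\<^sup>2) has_sum S) E"
  shows "A \<in> hilbert_schmidt"
  using assms by (auto simp: hilbert_schmidt_def summable_on_def)

lemma hs_inner_infsum:
  fixes A :: "'a::chilbert_space \<Rightarrow> 'a"
  assumes "bounded_clinear A"
  shows "hs_inner A B = (\<Sum>\<^sub>\<infinity>e\<in>trace_basis. cinner (A e) (B e))"
  by (simp add: hs_inner_def ctrace_def trace_basis_def cinner_cadjoint_right[OF assms])

text \<open>Links the trace over the chosen basis with sums over all other bases: one value
  \<open>S\<close> serves every \<open>E\<close>.\<close>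

lemma hs_inner_self_has_sum:
  fixes A :: "'a::chilbert_space \<Rightarrow> 'a"
  assumes A: "A \<in> hilbert_schmidt"
  obtains S where "S \<ge> 0" "hs_inner A A = complex_of_real S"
    "\<And>E. orthonormal_basis E \<Longrightarrow> ((\<lambda>e. (norm (A e))\<^sup>2) has_sum S) E"
proof -
  note bl = hilbert_schmidt_bounded_clinear[OF A]
  obtain E' S where E': "orthonormal_basis E'" "((\<lambda>e. (norm (A e))\<^sup>2) has_sum S) E'"
    using A by (auto simp: hilbert_schmidt_def summable_on_def)
  note S = has_sum_norm_basis_change[OF bl E'(1) _ E'(2)]
  have "S \<ge> 0" using E'(2) by (rule has_sum_nonneg) simp
  have "((\<lambda>e. complex_of_real ((norm (A e))\<^sup>2)) has_sum complex_of_real S) trace_basis"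
    by (rule has_sum_of_real) (rule S[OF orthonormal_trace_basis[OF A]])
  then have "hs_inner A A = complex_of_real S"
    unfolding hs_inner_infsum[OF bl] cinner_self by (rule infsumI)
  from that[OF \<open>S \<ge> 0\<close> this S] show thesis by blast
qed

lemma hs_norm_nonneg:
  fixes A :: "'a::chilbert_space \<Rightarrow> 'a"
  assumes "A \<in> hilbert_schmidt"
  shows "0 \<le> hs_norm A"
  by (rule hs_inner_self_has_sum[OF assms]) (simp add: hs_norm_def)

lemma hs_inner_self:
  fixes A :: "'a::chilbert_space \<Rightarrow> 'a"
  assumes "A \<in> hilbert_schmidt"
  shows "hs_inner A A = complex_of_real ((hs_norm A)\<^sup>2)"
  by (rule hs_inner_self_has_sum[OF assms]) (simp add: hs_norm_def)

lemma hs_norm_has_sum: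
  fixes A :: "'a::chilbert_space \<Rightarrow> 'a"
  assumes A: "A \<in> hilbert_schmidt" and E: "orthonormal_basis E"
  shows "((\<lambda>e. (norm (A e))\<^sup>2) has_sum (hs_norm A)\<^sup>2) E"
  by (rule hs_inner_self_has_sum[OF A]) (use E in \<open>simp add: hs_norm_def\<close>)

lemma hs_norm_eqI:
  fixes A :: "'a::chilbert_space \<Rightarrow> 'a"
  assumes A: "A \<in> hilbert_schmidt" and E: "orthonormal_basis E"
    and "((\<lambda>e. (norm (A e))\<^sup>2) has_sum S) E"
  shows "(hs_norm A)\<^sup>2 = S"
  using hs_norm_has_sum[OF A E] assms(3) by (rule has_sum_unique)

text \<open>Cauchy-Schwarz on finite sets, with a bound independent of the set, yields absolute
  summability and then passes to the infinite sum.\<close>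

lemma cinner_summable_and_bound:
  fixes A B :: "'a::chilbert_space \<Rightarrow> 'a"
  assumes A: "((\<lambda>e. (norm (A e))\<^sup>2) has_sum a\<^sup>2) E" and B: "((\<lambda>e. (norm (B e))\<^sup>2) has_sum b\<^sup>2) E"
    and nonneg: "a \<ge> 0" "b \<ge> 0"
  shows "(\<lambda>e. cinner (A e) (B e)) summable_on E"
    and "cmod (\<Sum>\<^sub>\<infinity>e\<in>E. cinner (A e) (B e)) \<le> a * b"
proof -
  let ?g = "\<lambda>e. cinner (A e) (B e)"
  have fin: "(\<Sum>e\<in>F. cmod (?g e)) \<le> a * b" if F: "finite F" "F \<subseteq> E" for F
  proof -
    have L2: "L2_set (\<lambda>e. norm (C e)) F \<le> c"
      if C: "((\<lambda>e. (norm (C e))\<^sup>2) has_sum c\<^sup>2) E" "c \<ge> 0" for C :: "'a \<Rightarrow> 'a" and c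
    proof -
      have "(\<Sum>e\<in>F. (norm (C e))\<^sup>2) \<le> c\<^sup>2"
        by (rule finite_sum_le_has_sum[OF C(1) F]) simp
      then show ?thesis unfolding L2_set_def by (rule real_le_lsqrt[OF C(2)])
    qed
    have "(\<Sum>e\<in>F. cmod (?g e)) \<le> (\<Sum>e\<in>F. \<bar>norm (A e)\<bar> * \<bar>norm (B e)\<bar>)"
      by (rule sum_mono) (simp add: cinner_Cauchy_Schwarz)
    also have "\<dots> \<le> L2_set (\<lambda>e. norm (A e)) F * L2_set (\<lambda>e. norm (B e)) F"
      by (rule L2_set_mult_ineq)
    also have "\<dots> \<le> a * b"
      by (intro mult_mono L2 A B nonneg L2_set_nonneg)
    finally show ?thesis .
  qed
  have abs: "(\<lambda>e. cmod (?g e)) summable_on E"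
    unfolding abs_summable_iff_bdd_above by (rule bdd_aboveI2) (use fin in auto)
  then show "?g summable_on E" by (rule abs_summable_summable)
  have "cmod (infsum ?g E) \<le> (\<Sum>\<^sub>\<infinity>e\<in>E. cmod (?g e))" by (rule norm_infsum_bound[OF abs])
  also have "\<dots> \<le> a * b" by (rule infsum_le_finite_sums[OF abs fin])
  finally show "cmod (infsum ?g E) \<le> a * b" .
qed

text \<open>Convergence is recorded because \<open>infsum\<close> alone returns 0 for a family that
  is not summable; additivity and conjugate symmetry then follow from uniqueness of sums.\<close>

lemma hs_inner_has_sum:
  fixes A B :: "'a::chilbert_space \<Rightarrow> 'a"
  assumes A: "A \<in> hilbert_schmidt" and B: "B \<in> hilbert_schmidt"
  shows "((\<lambda>e. cinner (A e) (B e)) has_sum hs_inner A B) trace_basis"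
  unfolding hs_inner_infsum[OF hilbert_schmidt_bounded_clinear[OF A]]
  by (rule has_sum_infsum[OF cinner_summable_and_bound(1)[OF hs_norm_has_sum[OF A] hs_norm_has_sum[OF B]
        hs_norm_nonneg[OF A] hs_norm_nonneg[OF B]]];
      rule orthonormal_trace_basis[OF A])

lemma hs_Cauchy_Schwarz:
  fixes A B :: "'a::chilbert_space \<Rightarrow> 'a"
  assumes A: "A \<in> hilbert_schmidt" and B: "B \<in> hilbert_schmidt"
  shows "cmod (hs_inner A B) \<le> hs_norm A * hs_norm B"
  unfolding hs_inner_infsum[OF hilbert_schmidt_bounded_clinear[OF A]]
  by (rule cinner_summable_and_bound(2)[OF hs_norm_has_sum[OF A] hs_norm_has_sum[OF B]
        hs_norm_nonneg[OF A] hs_norm_nonneg[OF B]];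
      rule orthonormal_trace_basis[OF A])

lemma hs_inner_commute:
  fixes A B :: "'a::chilbert_space \<Rightarrow> 'a"
  assumes "A \<in> hilbert_schmidt" "B \<in> hilbert_schmidt"
  shows "hs_inner A B = cnj (hs_inner B A)"
proof -
  have "((\<lambda>e. cnj (cinner (B e) (A e))) has_sum cnj (hs_inner B A)) trace_basis"
    unfolding has_sum_cnj_iff by (rule hs_inner_has_sum[OF assms(2,1)])
  moreover have "(\<lambda>e. cnj (cinner (B e) (A e))) = (\<lambda>e. cinner (A e) (B e))"
    by (rule ext) (rule cinner_commute[symmetric])
  ultimately show ?thesis
    using hs_inner_has_sum[OF assms] by (metis has_sum_unique)
qed

lemma hilbert_schmidt_add:
  fixes A B :: "'a::chilbert_space \<Rightarrow> 'a"
  assumes A: "A \<in> hilbert_schmidt" and B: "B \<in> hilbert_schmidt"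
  shows "(\<lambda>x. A x + B x) \<in> hilbert_schmidt"
proof -
  note bA = hilbert_schmidt_bounded_clinear[OF A] and bB = hilbert_schmidt_bounded_clinear[OF B]
  note E = orthonormal_trace_basis[OF A]
  obtain K L where K: "\<And>x. norm (A x) \<le> K * norm x" and L: "\<And>x. norm (B x) \<le> L * norm x"
    using bounded_clinear_bound[OF bA] bounded_clinear_bound[OF bB] by metis
  have "bounded_clinear (\<lambda>x. A x + B x)"
  proof (rule bounded_clinearI)
    show "norm (A x + B x) \<le> (K + L) * norm x" for x
      using norm_triangle_ineq[of "A x" "B x"] K[of x] L[of x] by (simp add: distrib_right)
  qed (simp_all add: bounded_clinearD[OF bA] bounded_clinearD[OF bB] scaleC_add_right)
  moreover have "(\<lambda>e. (norm (A e + B e))\<^sup>2) summable_on trace_basis"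
  proof (rule summable_on_comparison_test)
    show "(\<lambda>e. 2 * (norm (A e))\<^sup>2 + 2 * (norm (B e))\<^sup>2) summable_on trace_basis"
      by (intro summable_on_add summable_on_cmult_right)
        (rule has_sum_imp_summable[OF hs_norm_has_sum[OF A E]]
          has_sum_imp_summable[OF hs_norm_has_sum[OF B E]])+
    show "(norm (A e + B e))\<^sup>2 \<le> 2 * (norm (A e))\<^sup>2 + 2 * (norm (B e))\<^sup>2" for e
      using parallelogram_law[of "A e" "B e"] zero_le_power2[of "norm (A e - B e)"] by linarith
  qed simp
  ultimately show ?thesis using E by (auto simp: hilbert_schmidt_def)
qed

lemma hilbert_schmidt_scaleC:
  fixes A :: "'a::chilbert_space \<Rightarrow> 'a"
  assumes A: "A \<in> hilbert_schmidt"
  shows "(\<lambda>x. scaleC c (A x)) \<in> hilbert_schmidt"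
proof -
  note bA = hilbert_schmidt_bounded_clinear[OF A]
  obtain K where K: "\<And>x. norm (A x) \<le> K * norm x"
    using bounded_clinear_bound[OF bA] by metis
  have "bounded_clinear (\<lambda>x. scaleC c (A x))"
  proof (rule bounded_clinearI)
    show "norm (scaleC c (A x)) \<le> (cmod c * K) * norm x" for x
      using mult_left_mono[OF K, of "cmod c" x] by (simp add: norm_scaleC mult.assoc)
  qed (simp_all add: bounded_clinearD[OF bA] scaleC_add_right cvec.scale_left_commute)
  moreover have "((\<lambda>e. (norm (scaleC c (A e)))\<^sup>2) has_sum (cmod c)\<^sup>2 * (hs_norm A)\<^sup>2) trace_basis"
    unfolding norm_scaleC power_mult_distrib
    by (intro has_sum_cmult_right hs_norm_has_sum A orthonormal_trace_basis[OF A])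
  ultimately show ?thesis by (rule hilbert_schmidtI[OF _ orthonormal_trace_basis[OF A]])
qed

lemma hilbert_schmidt_diff:
  fixes A B :: "'a::chilbert_space \<Rightarrow> 'a"
  assumes "A \<in> hilbert_schmidt" "B \<in> hilbert_schmidt"
  shows "(\<lambda>x. A x - B x) \<in> hilbert_schmidt"
  using hilbert_schmidt_add[OF assms(1) hilbert_schmidt_scaleC[OF assms(2), of "- 1"]]
  by simp

lemma hs_inner_add_right:
  fixes A B C :: "'a::chilbert_space \<Rightarrow> 'a"
  assumes "A \<in> hilbert_schmidt" "B \<in> hilbert_schmidt" "C \<in> hilbert_schmidt"
  shows "hs_inner A (\<lambda>x. B x + C x) = hs_inner A B + hs_inner A C"
proof (rule has_sum_unique)
  show "((\<lambda>e. cinner (A e) (B e + C e)) has_sum hs_inner A (\<lambda>x. B x + C x)) trace_basis"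
    using assms by (intro hs_inner_has_sum hilbert_schmidt_add)
  show "((\<lambda>e. cinner (A e) (B e + C e)) has_sum (hs_inner A B + hs_inner A C)) trace_basis"
    unfolding cinner_add_right using assms by (intro has_sum_add hs_inner_has_sum)
qed

lemma hs_inner_add_left:
  fixes A B C :: "'a::chilbert_space \<Rightarrow> 'a"
  assumes "A \<in> hilbert_schmidt" "B \<in> hilbert_schmidt" "C \<in> hilbert_schmidt"
  shows "hs_inner (\<lambda>x. A x + B x) C = hs_inner A C + hs_inner B C"
  using hs_inner_add_right[OF assms(3,1,2)] hilbert_schmidt_add[OF assms(1,2)] assms
  by (simp add: hs_inner_commute[of _ C])

lemma hs_inner_scaleC_right:
  fixes A B :: "'a::chilbert_space \<Rightarrow> 'a"
  assumes "A \<in> hilbert_schmidt" "B \<in> hilbert_schmidt"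
  shows "hs_inner A (\<lambda>x. scaleC c (B x)) = c * hs_inner A B"
  by (simp add: hs_inner_infsum[OF hilbert_schmidt_bounded_clinear[OF assms(1)]]
      cinner_scaleC_right infsum_cmult_right')

section \<open>Approximation by finite rank operators\<close>

lemma bounded_clinear_rank_one:
  fixes e t :: "'a::complex_inner"
  shows "bounded_clinear (\<lambda>x. scaleC (cinner e x) t)"
proof (rule bounded_clinearI)
  show "norm (scaleC (cinner e x) t) \<le> (norm e * norm t) * norm x" for x
    using mult_right_mono[OF cinner_Cauchy_Schwarz, of "norm t" e x]
    by (simp add: norm_scaleC ac_simps)
qed (simp_all add: cinner_add_right cinner_scaleC_right scaleC_add_left scaleC_scaleC)

text \<open>The sum of squares is Parseval's expansion of \<open>e\<close>, scaled by
  \<open>(norm t)\<^sup>2\<close>.\<close>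

lemma hilbert_schmidt_rank_one:
  fixes e t :: "'a::chilbert_space"
  assumes "orthonormal_basis (E :: 'a set)"
  shows "(\<lambda>x. scaleC (cinner e x) t) \<in> hilbert_schmidt"
proof (rule hilbert_schmidtI[OF bounded_clinear_rank_one assms])
  have "((\<lambda>f. (cmod (cinner f e))\<^sup>2 * (norm t)\<^sup>2) has_sum ((norm e)\<^sup>2 * (norm t)\<^sup>2)) E"
    by (intro has_sum_cmult_left parseval assms)
  moreover have "cmod (cinner e f) = cmod (cinner f e)" for f
    by (subst cinner_commute) simp
  ultimately show "((\<lambda>f. (norm (scaleC (cinner e f) t))\<^sup>2) has_sum ((norm e)\<^sup>2 * (norm t)\<^sup>2)) E"
    by (simp add: norm_scaleC power_mult_distrib)
qed

lemma hilbert_schmidt_zero: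
  assumes "orthonormal_basis (E :: 'a::chilbert_space set)"
  shows "(\<lambda>x :: 'a. 0) \<in> hilbert_schmidt"
  using hilbert_schmidt_rank_one[OF assms, of 0 0] by simp

text \<open>For linear \<open>X\<close> and orthonormal \<open>F\<close> this is \<open>X\<close>
  after the orthogonal projection on the span of \<open>F\<close>; writing it as a sum of rank one
  operators suits induction on \<open>F\<close>.\<close>

definition restrict_op :: "('a::complex_inner \<Rightarrow> 'a) \<Rightarrow> 'a set \<Rightarrow> 'a \<Rightarrow> 'a" where
  "restrict_op X F = (\<lambda>x. \<Sum>e\<in>F. scaleC (cinner e x) (X e))"

lemma restrict_op_insert:
  assumes "finite F" "e \<notin> F"
  shows "restrict_op X (insert e F) = (\<lambda>x. scaleC (cinner e x) (X e) + restrict_op X F x)"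
  using assms by (simp add: restrict_op_def)

lemma restrict_op_hilbert_schmidt:
  fixes X :: "'a::chilbert_space \<Rightarrow> 'a"
  assumes "orthonormal_basis (E :: 'a set)" "finite F"
  shows "restrict_op X F \<in> hilbert_schmidt"
  using assms(2)
proof (induction F)
  case empty
  then show ?case using hilbert_schmidt_zero[OF assms(1)] by (simp add: restrict_op_def)
next
  case (insert e F)
  then show ?case
    using hilbert_schmidt_add[OF hilbert_schmidt_rank_one[OF assms(1)] insert.IH]
    by (simp add: restrict_op_insert)
qed

lemma restrict_op_basis:
  fixes X :: "'a::chilbert_space \<Rightarrow> 'a"
  assumes E: "orthonormal_basis E" and F: "finite F" "F \<subseteq> E" and f: "f \<in> E"
  shows "restrict_op X F f = (if f \<in> F then X f else 0)"
proof -
  have "restrict_op X F f = (\<Sum>e\<in>F. if e = f then X e else 0)"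
    unfolding restrict_op_def
  proof (rule sum.cong)
    fix e assume "e \<in> F"
    then have "cinner e f = (if e = f then 1 else 0)"
      using orthonormal_basis_cinner[OF E _ f] F(2) by blast
    then show "scaleC (cinner e f) (X e) = (if e = f then X e else 0)" by simp
  qed simp
  then show ?thesis using F(1) by simp
qed

text \<open>On \<open>E\<close> the restricted operator agrees with \<open>X\<close> on
  \<open>F\<close> and vanishes elsewhere, so the two squared norms are a partial sum and a tail of
  the series for \<open>X\<close>.\<close>

lemma hs_norm_restrict_op:
  fixes X :: "'a::chilbert_space \<Rightarrow> 'a"
  assumes X: "X \<in> hilbert_schmidt" and E: "orthonormal_basis E" and F: "finite F" "F \<subseteq> E"
  shows "(hs_norm (restrict_op X F))\<^sup>2 = (\<Sum>e\<in>F. (norm (X e))\<^sup>2)"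
    and "(hs_norm (\<lambda>x. X x - restrict_op X F x))\<^sup>2 = (hs_norm X)\<^sup>2 - (\<Sum>e\<in>F. (norm (X e))\<^sup>2)"
    and "hs_norm (restrict_op X F) \<le> hs_norm X"
proof -
  let ?S = "\<Sum>e\<in>F. (norm (X e))\<^sup>2"
  note R = restrict_op_hilbert_schmidt[OF E F(1), of X]
  note basis = restrict_op_basis[OF E F]
  note sum_X = hs_norm_has_sum[OF X E]
  have sum_F: "((\<lambda>e. (norm (X e))\<^sup>2) has_sum ?S) F"
    by (rule has_sum_finite[OF F(1)])
  have "((\<lambda>e. (norm (restrict_op X F e))\<^sup>2) has_sum ?S) E \<longleftrightarrow>
      ((\<lambda>e. (norm (X e))\<^sup>2) has_sum ?S) F"
    by (rule has_sum_cong_neutral) (use F(2) in \<open>auto simp: basis\<close>)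
  with sum_F show norm_R: "(hs_norm (restrict_op X F))\<^sup>2 = ?S"
    by (intro hs_norm_eqI[OF R E]) simp
  have "((\<lambda>e. (norm (X e - restrict_op X F e))\<^sup>2) has_sum ((hs_norm X)\<^sup>2 - ?S)) E \<longleftrightarrow>
      ((\<lambda>e. (norm (X e))\<^sup>2) has_sum ((hs_norm X)\<^sup>2 - ?S)) (E - F)"
    by (rule has_sum_cong_neutral) (use F(2) in \<open>auto simp: basis\<close>)
  with has_sum_Diff[OF sum_X sum_F F(2)]
  show "(hs_norm (\<lambda>x. X x - restrict_op X F x))\<^sup>2 = (hs_norm X)\<^sup>2 - ?S"
    by (intro hs_norm_eqI[OF hilbert_schmidt_diff[OF X R] E]) simp
  have "?S \<le> (hs_norm X)\<^sup>2"
    by (rule finite_sum_le_has_sum[OF sum_X F]) simp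
  then show "hs_norm (restrict_op X F) \<le> hs_norm X"
    unfolding norm_R[symmetric] using hs_norm_nonneg[OF X] power2_le_imp_le by blast
qed

lemma restrict_op_approx:
  fixes X :: "'a::chilbert_space \<Rightarrow> 'a"
  assumes X: "X \<in> hilbert_schmidt" and E: "orthonormal_basis E" and "\<epsilon> > 0"
  obtains F where "finite F" "F \<subseteq> E" "hs_norm (\<lambda>x. X x - restrict_op X F x) \<le> \<epsilon>"
proof -
  obtain F where F: "finite F" "F \<subseteq> E"
      "dist (\<Sum>e\<in>F. (norm (X e))\<^sup>2) ((hs_norm X)\<^sup>2) \<le> \<epsilon>\<^sup>2"
    using has_sum_finite_approximation[OF hs_norm_has_sum[OF X E], of "\<epsilon>\<^sup>2"] \<open>\<epsilon> > 0\<close> by auto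
  have "(hs_norm (\<lambda>x. X x - restrict_op X F x))\<^sup>2 \<le> \<epsilon>\<^sup>2"
    using F(3) unfolding hs_norm_restrict_op(2)[OF X E F(1,2)] dist_real_def by linarith
  then have "hs_norm (\<lambda>x. X x - restrict_op X F x) \<le> \<epsilon>"
    by (rule power2_le_imp_le) (use \<open>\<epsilon> > 0\<close> in simp)
  with F that show thesis by blast
qed

text \<open>The density argument in reusable form: additivity disposes of the finite rank part and
  the bound controls the rest. Asking for additivity in place of linearity covers conjugate-linear
  functionals too.\<close>

lemma hs_functional_eq_zero:
  fixes \<Phi> :: "('a::chilbert_space \<Rightarrow> 'a) \<Rightarrow> complex"
  assumes E: "orthonormal_basis E"
    and add: "\<And>X Y. X \<in> hilbert_schmidt \<Longrightarrow> Y \<in> hilbert_schmidt \<Longrightarrow>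
      \<Phi> (\<lambda>x. X x + Y x) = \<Phi> X + \<Phi> Y"
    and bound: "\<And>X. X \<in> hilbert_schmidt \<Longrightarrow> cmod (\<Phi> X) \<le> C * hs_norm X"
    and rank_one: "\<And>e t. e \<in> E \<Longrightarrow> \<Phi> (\<lambda>x. scaleC (cinner e x) t) = 0"
    and X: "X \<in> hilbert_schmidt"
  shows "\<Phi> X = 0"
proof -
  have zero: "\<Phi> (\<lambda>x. 0) = 0"
    using add[OF hilbert_schmidt_zero[OF E] hilbert_schmidt_zero[OF E]] by simp
  have fin: "\<Phi> (restrict_op X F) = 0" if "finite F" "F \<subseteq> E" for F
    using that
  proof (induction F)
    case empty
    then show ?case by (simp add: restrict_op_def zero)
  next
    case (insert e F)
    then show ?case
      using add[OF hilbert_schmidt_rank_one[OF E] restrict_op_hilbert_schmidt[OF E]]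
      by (simp add: restrict_op_insert rank_one)
  qed
  have "cmod (\<Phi> X) \<le> 0 + \<delta>" if "\<delta> > 0" for \<delta>
  proof -
    \<comment> \<open>Adding 1 to \<open>\<bar>C\<bar>\<close> keeps the divisor positive even for
      \<open>C = 0\<close>.\<close>
    define \<epsilon> where "\<epsilon> = \<delta> / (\<bar>C\<bar> + 1)"
    have "\<epsilon> > 0" using \<open>\<delta> > 0\<close> by (simp add: \<epsilon>_def)
    then obtain F where F: "finite F" "F \<subseteq> E" "hs_norm (\<lambda>x. X x - restrict_op X F x) \<le> \<epsilon>"
      using restrict_op_approx[OF X E] by blast
    let ?R = "restrict_op X F" and ?Y = "\<lambda>x. X x - restrict_op X F x"
    have R: "?R \<in> hilbert_schmidt" by (rule restrict_op_hilbert_schmidt[OF E F(1)])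
    have Y: "?Y \<in> hilbert_schmidt" by (rule hilbert_schmidt_diff[OF X R])
    have "\<Phi> X = \<Phi> (\<lambda>x. ?Y x + ?R x)" by simp
    also have "\<dots> = \<Phi> ?Y" unfolding add[OF Y R] fin[OF F(1,2)] by simp
    finally have "cmod (\<Phi> X) \<le> C * hs_norm ?Y" using bound[OF Y] by simp
    also have "\<dots> \<le> (\<bar>C\<bar> + 1) * \<epsilon>"
      by (rule mult_mono) (use F(3) hs_norm_nonneg[OF Y] in auto)
    also have "\<dots> = \<delta>" by (simp add: \<epsilon>_def)
    finally show ?thesis by simp
  qed
  then have "cmod (\<Phi> X) \<le> 0" by (rule field_le_epsilon)
  then show ?thesis by simp
qed

text \<open>Orthonormality leaves a single nonzero term in the trace; this is why \<open>f\<close>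
  is taken from \<open>trace_basis\<close>.\<close>

lemma hs_inner_rank_one:
  fixes X :: "'a::chilbert_space \<Rightarrow> 'a"
  assumes X: "X \<in> hilbert_schmidt" and f: "f \<in> trace_basis"
  shows "hs_inner X (\<lambda>x. scaleC (cinner f x) t) = cinner (X f) t"
proof -
  note E = orthonormal_trace_basis[OF X]
  have "((\<lambda>e. cinner (X e) (scaleC (cinner f e) t)) has_sum cinner (X f) t) trace_basis"
  proof (rule has_sum_finite_neutralI)
    show "finite {f}" "{f} \<subseteq> trace_basis" using f by auto
    show "cinner (X e) (scaleC (cinner f e) t) = 0" if "e \<in> trace_basis - {f}" for e
      using orthonormal_basis_cinner[OF E f, of e] that
      by (auto simp: cinner.zero_right)
    have "cinner f f = 1" using orthonormal_basis_cinner[OF E f f] by simp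
    then show "cinner (X f) t = (\<Sum>e\<in>{f}. cinner (X e) (scaleC (cinner f e) t))"
      by simp
  qed
  then show ?thesis
    by (rule has_sum_unique[OF hs_inner_has_sum[OF X hilbert_schmidt_rank_one[OF E]]])
qed

section \<open>Two-sided translates of Hilbert-Schmidt operators\<close>

lemma orthonormal_basis_unitary_image:
  fixes V :: "'a::chilbert_space \<Rightarrow> 'a"
  assumes V: "unitary_op V" and E: "orthonormal_basis E"
  shows "orthonormal_basis (V ` E)"
proof -
  note lin = bounded_clinearD[OF unitary_opD(3)[OF V]]
  have "cinner (V e) (V f) = (if V e = V f then 1 else 0)" if "e \<in> E" "f \<in> E" for e f
  proof -
    have "V e = V f \<longleftrightarrow> e = f" using unitary_opD(5)[OF V] by metis
    then show ?thesis
      unfolding unitary_opD(1)[OF V] using orthonormal_basis_cinner[OF E that] by simp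
  qed
  moreover have "y \<in> closure (cvec.span (V ` E))" for y
    unfolding closure_approachable
  proof (intro allI impI)
    fix \<epsilon> :: real assume "\<epsilon> > 0"
    \<comment> \<open>Since \<open>V\<close> is isometric and onto, approximating \<open>y\<close>
      in the span of the image basis amounts to approximating \<open>cadjoint V y\<close> in the
      span of \<open>E\<close>.\<close>
    have "cadjoint V y \<in> closure (cvec.span E)" using E by (simp add: orthonormal_basis_def)
    then obtain z where z: "z \<in> cvec.span E" "dist z (cadjoint V y) < \<epsilon>"
      using \<open>\<epsilon> > 0\<close> unfolding closure_approachable by blast
    then obtain F r where F: "finite F" "F \<subseteq> E" "z = (\<Sum>a\<in>F. scaleC (r a) a)"
      unfolding cvec.span_explicit by blast
    have "V z = (\<Sum>a\<in>F. scaleC (r a) (V a))" unfolding F(3) lin by simp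
    moreover have "(\<Sum>a\<in>F. scaleC (r a) (V a)) \<in> cvec.span (V ` E)"
      by (rule cvec.span_sum, rule cvec.span_scale, rule cvec.span_base) (use F(2) in blast)
    ultimately have "V z \<in> cvec.span (V ` E)" by simp
    moreover have "dist (V z) y = dist z (cadjoint V y)"
      using unitary_opD(2)[OF V, of "z - cadjoint V y"]
      by (simp add: dist_norm lin unitary_opD(6)[OF V])
    ultimately show "\<exists>w\<in>cvec.span (V ` E). dist w y < \<epsilon>" using z(2) by metis
  qed
  ultimately show ?thesis unfolding orthonormal_basis_def by blast
qed

text \<open>Summing over the image of the basis under \<open>W\<close> cancels the adjoint of
  \<open>W\<close>, and \<open>V\<close> preserves norms, so the terms are those of
  \<open>T\<close>. Basis independence then identifies the sum with the squared norm.\<close>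

lemma unitary_conjugate_hilbert_schmidt:
  fixes V W T :: "'a::chilbert_space \<Rightarrow> 'a"
  assumes V: "unitary_op V" and W: "unitary_op W" and T: "T \<in> hilbert_schmidt"
  shows "V \<circ> T \<circ> cadjoint W \<in> hilbert_schmidt"
    and "hs_norm (V \<circ> T \<circ> cadjoint W) = hs_norm T"
proof -
  note E = orthonormal_trace_basis[OF T]
  note E' = orthonormal_basis_unitary_image[OF W E]
  note bT = hilbert_schmidt_bounded_clinear[OF T]
  note bV = unitary_opD(3)[OF V] and bW = bounded_clinear_cadjoint[OF unitary_opD(3)[OF W]]
  obtain K where K: "\<And>x. norm (T x) \<le> K * norm x" using bounded_clinear_bound[OF bT] by metis
  have norm_W: "norm (cadjoint W x) = norm x" for x
    using unitary_opD(2)[OF W, of "cadjoint W x"] by (simp add: unitary_opD(6)[OF W])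
  have bl: "bounded_clinear (V \<circ> T \<circ> cadjoint W)"
  proof (rule bounded_clinearI)
    show "norm ((V \<circ> T \<circ> cadjoint W) x) \<le> K * norm x" for x
      using K[of "cadjoint W x"] by (simp add: unitary_opD(2)[OF V] norm_W)
  qed (simp_all add: bounded_clinearD[OF bT] bounded_clinearD[OF bV] bounded_clinearD[OF bW])
  have inj: "inj_on W trace_basis" using unitary_opD(5)[OF W] by (metis inj_onI)
  have sum: "((\<lambda>e. (norm ((V \<circ> T \<circ> cadjoint W) e))\<^sup>2) has_sum (hs_norm T)\<^sup>2) (W ` trace_basis)"
    unfolding has_sum_reindex[OF inj] using hs_norm_has_sum[OF T E]
    by (simp add: o_def unitary_opD(5)[OF W] unitary_opD(2)[OF V])
  show mem: "V \<circ> T \<circ> cadjoint W \<in> hilbert_schmidt"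
    by (rule hilbert_schmidtI[OF bl E' sum])
  show "hs_norm (V \<circ> T \<circ> cadjoint W) = hs_norm T"
    by (rule power2_eq_imp_eq[OF hs_norm_eqI[OF mem E' sum] hs_norm_nonneg[OF mem]
        hs_norm_nonneg[OF T]])
qed

section \<open>Integration\<close>

lemma (in pair_sigma_finite) integral_tensor:
  fixes a :: "'a \<Rightarrow> complex" and b :: "'b \<Rightarrow> complex"
  assumes a: "integrable M1 a" and b: "integrable M2 b"
  shows "integrable (M1 \<Otimes>\<^sub>M M2) (\<lambda>p. a (fst p) * b (snd p))"
    and "(LINT p|(M1 \<Otimes>\<^sub>M M2). a (fst p) * b (snd p)) = (LINT x|M1. a x) * (LINT y|M2. b y)"
proof -
  have [measurable]: "a \<in> borel_measurable M1" "b \<in> borel_measurable M2"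
    using a b by auto
  show int: "integrable (M1 \<Otimes>\<^sub>M M2) (\<lambda>p. a (fst p) * b (snd p))"
  proof (rule Fubini_integrable)
    show "integrable M1 (\<lambda>x. LINT y|M2. norm (a (fst (x, y)) * b (snd (x, y))))"
      using a by (simp add: norm_mult)
    show "AE x in M1. integrable M2 (\<lambda>y. a (fst (x, y)) * b (snd (x, y)))"
      using b by simp
  qed simp
  show "(LINT p|(M1 \<Otimes>\<^sub>M M2). a (fst p) * b (snd p)) = (LINT x|M1. a x) * (LINT y|M2. b y)"
    by (simp flip: integral_fst'[OF int])
qed

lemma borel_measurable_cnj [measurable (raw)]:
  "f \<in> borel_measurable M \<Longrightarrow> (\<lambda>x. cnj (f x)) \<in> borel_measurable M"
  by (rule borel_measurable_continuous_on[of cnj]) (intro continuous_intros)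

text \<open>Bounds on nonnegative integrals already contain finiteness, so Cauchy-Schwarz in the
  extended reals yields integrability of the product along with the estimate.\<close>

lemma L2_product_bound:
  fixes u v :: "'a \<Rightarrow> complex"
  assumes u: "u \<in> borel_measurable M" "(\<integral>\<^sup>+x. ennreal ((cmod (u x))\<^sup>2) \<partial>M) \<le> ennreal (c\<^sup>2)"
    and v: "v \<in> borel_measurable M" "(\<integral>\<^sup>+x. ennreal ((cmod (v x))\<^sup>2) \<partial>M) \<le> ennreal (d\<^sup>2)"
    and nonneg: "c \<ge> 0" "d \<ge> 0"
  shows "integrable M (\<lambda>x. cnj (u x) * v x)" and "cmod (LINT x|M. cnj (u x) * v x) \<le> c * d"
proof -
  note [measurable] = u(1) v(1)
  define N where "N = (\<integral>\<^sup>+x. ennreal (cmod (u x)) * ennreal (cmod (v x)) \<partial>M)"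
  have "N\<^sup>2 \<le> (\<integral>\<^sup>+x. (ennreal (cmod (u x)))\<^sup>2 \<partial>M) * (\<integral>\<^sup>+x. (ennreal (cmod (v x)))\<^sup>2 \<partial>M)"
    unfolding N_def by (rule Cauchy_Schwarz_nn_integral) measurable
  also have "\<dots> \<le> ennreal (c\<^sup>2) * ennreal (d\<^sup>2)"
    using u(2) v(2) by (intro mult_mono) (simp_all add: ennreal_power)
  also have "\<dots> = ennreal ((c * d)\<^sup>2)" by (simp add: power_mult_distrib ennreal_mult)
  finally have N2: "N\<^sup>2 \<le> ennreal ((c * d)\<^sup>2)" .
  then have "N \<noteq> top" by (auto simp: top_unique)
  then obtain r where r: "r \<ge> 0" "N = ennreal r" by (cases N) auto
  have "r\<^sup>2 \<le> (c * d)\<^sup>2" using N2 r by (simp add: ennreal_power)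
  then have "r \<le> c * d" by (rule power2_le_imp_le) (use nonneg in simp)
  have norm_eq: "(\<integral>\<^sup>+x. ennreal (norm (cnj (u x) * v x)) \<partial>M) = ennreal r"
    unfolding r(2)[symmetric] N_def by (simp add: norm_mult ennreal_mult)
  show int: "integrable M (\<lambda>x. cnj (u x) * v x)"
    unfolding integrable_iff_bounded norm_eq
    by (intro conjI borel_measurable_times borel_measurable_cnj v u) simp
  have "ennreal (cmod (LINT x|M. cnj (u x) * v x)) \<le> ennreal r"
    unfolding norm_eq[symmetric] by (rule integral_norm_bound_ennreal[OF int])
  then have "cmod (LINT x|M. cnj (u x) * v x) \<le> r" using r(1) by simp
  with \<open>r \<le> c * d\<close> show "cmod (LINT x|M. cnj (u x) * v x) \<le> c * d" by simp
qed

text \<open>Lindelof extracts a countable cover from the open sets contained in compact ones, on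
  which Haar measure is finite. Product measures and Fubini rely on this.\<close>

lemma sigma_finite_haar_measure:
  fixes \<mu> :: "'g::{topological_group_add, t2_space, second_countable_topology} measure"
  assumes "locally_compact_space (euclidean :: 'g topology)" and "haar_measure \<mu>"
  shows "sigma_finite_measure \<mu>"
proof
  define \<F> where "\<F> = {S :: 'g set. open S \<and> (\<exists>K. compact K \<and> S \<subseteq> K)}"
  obtain \<F>' where \<F>': "\<F>' \<subseteq> \<F>" "countable \<F>'" "\<Union>\<F>' = \<Union>\<F>"
    by (rule Lindelof[of \<F>]) (auto simp: \<F>_def)
  have cover: "\<Union>\<F> = UNIV"
    using assms(1) unfolding locally_compact_space_def \<F>_def by fastforce
  have sets: "sets \<mu> = sets borel" using assms(2) by (simp add: haar_measure_def)
  then have space: "space \<mu> = UNIV" by (metis sets_eq_imp_space_eq space_borel)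
  have "emeasure \<mu> S \<noteq> \<infinity>" if "S \<in> \<F>'" for S
  proof -
    from that \<F>'(1) obtain K where K: "compact K" "S \<subseteq> K" by (auto simp: \<F>_def)
    have "emeasure \<mu> S \<le> emeasure \<mu> K"
      by (rule emeasure_mono) (use K in \<open>simp_all add: sets compact_imp_closed\<close>)
    also have "\<dots> < \<infinity>" using assms(2) K(1) by (simp add: haar_measure_def)
    finally show ?thesis by simp
  qed
  moreover have "\<F>' \<subseteq> sets \<mu>" using \<F>'(1) by (auto simp: sets \<F>_def)
  ultimately show "\<exists>A. countable A \<and> A \<subseteq> sets \<mu> \<and> \<Union> A = space \<mu> \<and> (\<forall>a\<in>A. emeasure \<mu> a \<noteq> \<infinity>)"
    using \<F>' cover space by (intro exI[of _ \<F>']) auto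
qed

section \<open>Square integrable representations\<close>

text \<open>The Duflo-Moore relation appears here as an assumption on coefficient functions, with
  its constant normalized to 1.\<close>

locale orthogonal_coefficients = sigma_finite_measure \<mu>
  for \<mu> :: "'g::{topological_group_add, t2_space, second_countable_topology} measure" +
  fixes U :: "'g \<Rightarrow> 'h::chilbert_space \<Rightarrow> 'h"
  assumes sets_eq_borel: "sets \<mu> = sets borel"
    and unitary: "unitary_op (U g)"
    and coefficient_measurable_borel: "(\<lambda>g. cinner \<phi> (U g \<psi>)) \<in> borel_measurable borel"
    and orthogonality: "(LINT g|\<mu>. cinner \<phi>1 (U g \<psi>1) * cinner (U g \<psi>2) \<phi>2) =
      cinner \<phi>1 \<phi>2 * cinner \<psi>2 \<psi>1"
begin

sublocale pair_sigma_finite \<mu> \<mu> ..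

lemma coefficient_measurable [measurable]:
  "(\<lambda>g. cinner \<phi> (U g \<psi>)) \<in> borel_measurable \<mu>"
  "(\<lambda>g. cinner (U g \<psi>) \<phi>) \<in> borel_measurable \<mu>"
proof -
  show 1: "(\<lambda>g. cinner \<phi> (U g \<psi>)) \<in> borel_measurable \<mu>" for \<phi> \<psi>
    using coefficient_measurable_borel[of \<phi> \<psi>] measurable_cong_sets[OF sets_eq_borel refl] by blast
  have "(\<lambda>g. cnj (cinner \<phi> (U g \<psi>))) \<in> borel_measurable \<mu>"
    by (rule borel_measurable_cnj[OF 1])
  then show "(\<lambda>g. cinner (U g \<psi>) \<phi>) \<in> borel_measurable \<mu>"
    unfolding cinner_commute[symmetric] .
qed

text \<open>The Bochner integral of a non-integrable function is \<open>0\<close>, so a nonzero value in the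
  orthogonality relation entails integrability.\<close>

lemma coefficient_square_integrable:
  "integrable \<mu> (\<lambda>g. (cmod (cinner \<phi> (U g \<psi>)))\<^sup>2)"
proof (cases "\<phi> = 0 \<or> \<psi> = 0")
  case True
  then have "cinner \<phi> (U g \<psi>) = 0" for g
    by (auto simp: cinner.zero_left cinner.zero_right bounded_clinearD(3)[OF unitary_opD(3)[OF unitary]])
  then show ?thesis by simp
next
  case False
  then have "(LINT g|\<mu>. cinner \<phi> (U g \<psi>) * cinner (U g \<psi>) \<phi>) \<noteq> 0"
    unfolding orthogonality cinner_self by simp
  then have "integrable \<mu> (\<lambda>g. cinner \<phi> (U g \<psi>) * cinner (U g \<psi>) \<phi>)"
    by (metis not_integrable_integral_eq)
  then have "integrable \<mu> (\<lambda>g. cmod (cinner \<phi> (U g \<psi>) * cinner (U g \<psi>) \<phi>))"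
    by (rule integrable_norm)
  moreover have "cmod (cinner \<phi> (U g \<psi>) * cinner (U g \<psi>) \<phi>) = (cmod (cinner \<phi> (U g \<psi>)))\<^sup>2" for g
    unfolding cinner_commute[of "U g \<psi>" \<phi>] by (simp add: norm_mult power2_eq_square)
  ultimately show ?thesis by simp
qed

text \<open>When the value of the orthogonality relation is 0 it says nothing about integrability,
  so the product is dominated by a sum of two integrable squares.\<close>

lemma coefficient_product_integrable:
  "integrable \<mu> (\<lambda>g. cinner \<phi>1 (U g \<psi>1) * cinner (U g \<psi>2) \<phi>2)"
proof (rule Bochner_Integration.integrable_bound)
  show "integrable \<mu> (\<lambda>g. (cmod (cinner \<phi>1 (U g \<psi>1)))\<^sup>2 + (cmod (cinner \<phi>2 (U g \<psi>2)))\<^sup>2)"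
    by (intro Bochner_Integration.integrable_add coefficient_square_integrable)
  show "AE g in \<mu>. norm (cinner \<phi>1 (U g \<psi>1) * cinner (U g \<psi>2) \<phi>2)
      \<le> norm ((cmod (cinner \<phi>1 (U g \<psi>1)))\<^sup>2 + (cmod (cinner \<phi>2 (U g \<psi>2)))\<^sup>2)"
  proof (rule AE_I2)
    fix g
    let ?a = "cmod (cinner \<phi>1 (U g \<psi>1))" and ?b = "cmod (cinner \<phi>2 (U g \<psi>2))"
    have "?a * ?b \<le> ?a\<^sup>2 + ?b\<^sup>2"
      using sum_squares_bound[of ?a ?b] mult_nonneg_nonneg[of ?a ?b, OF norm_ge_zero norm_ge_zero]
      by linarith
    then show "norm (cinner \<phi>1 (U g \<psi>1) * cinner (U g \<psi>2) \<phi>2) \<le> norm (?a\<^sup>2 + ?b\<^sup>2)"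
      unfolding cinner_commute[of "U g \<psi>2" \<phi>2] by (simp add: norm_mult)
  qed
qed measurable

text \<open>The value at \<open>(g\<^sub>1, g\<^sub>2)\<close> of the transform of \<open>|a\<rangle>\<langle>f|\<close> with respect to
  \<open>|t\<rangle>\<langle>e|\<close>.\<close>

definition tensor_coefficient :: "'h \<Rightarrow> 'h \<Rightarrow> 'h \<Rightarrow> 'h \<Rightarrow> 'g \<times> 'g \<Rightarrow> complex" where
  "tensor_coefficient e t f a p = cinner (U (fst p) t) a * cinner f (U (snd p) e)"

lemma tensor_coefficient_measurable [measurable]:
  "tensor_coefficient e t f a \<in> borel_measurable (\<mu> \<Otimes>\<^sub>M \<mu>)"
  unfolding tensor_coefficient_def[abs_def] by measurable

lemma tensor_coefficient_orthogonality:
  "integrable (\<mu> \<Otimes>\<^sub>M \<mu>) (\<lambda>p. cnj (tensor_coefficient e t f a p) * tensor_coefficient e' t' f' a' p)"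
  "(LINT p|(\<mu> \<Otimes>\<^sub>M \<mu>). cnj (tensor_coefficient e t f a p) * tensor_coefficient e' t' f' a' p)
    = (cinner a a' * cinner t' t) * (cinner f' f * cinner e e')"
proof -
  \<comment> \<open>Conjugation swaps the arguments of \<open>cinner\<close>; regrouping by group
    variable makes each bracket an integrand of \<open>orthogonality\<close>.\<close>
  have eq: "(\<lambda>p. cnj (tensor_coefficient e t f a p) * tensor_coefficient e' t' f' a' p)
    = (\<lambda>p. (cinner a (U (fst p) t) * cinner (U (fst p) t') a')
        * (cinner f' (U (snd p) e') * cinner (U (snd p) e) f))"
    by (rule ext) (simp add: tensor_coefficient_def ac_simps flip: cinner_commute)
  show "integrable (\<mu> \<Otimes>\<^sub>M \<mu>) (\<lambda>p. cnj (tensor_coefficient e t f a p) * tensor_coefficient e' t' f' a' p)"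
    unfolding eq by (rule integral_tensor(1); rule coefficient_product_integrable)
  show "(LINT p|(\<mu> \<Otimes>\<^sub>M \<mu>). cnj (tensor_coefficient e t f a p) * tensor_coefficient e' t' f' a' p)
    = (cinner a a' * cinner t' t) * (cinner f' f * cinner e e')"
    unfolding eq integral_tensor(2)[OF coefficient_product_integrable coefficient_product_integrable]
      orthogonality ..
qed

text \<open>Pythagoras for the family indexed by \<open>F \<times> G\<close>. The vectors
  \<open>T e\<close> and \<open>A f\<close> need not be orthogonal; cross terms vanish through the
  factors \<open>cinner f' f\<close> and \<open>cinner e e'\<close>.\<close>

lemma nn_integral_tensor_coefficient_sum:
  fixes T A :: "'h \<Rightarrow> 'h"
  assumes E: "orthonormal_basis E" and F: "finite F" "F \<subseteq> E" and G: "finite G" "G \<subseteq> E"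
  shows "(\<integral>\<^sup>+p. ennreal ((cmod (\<Sum>f\<in>F. \<Sum>e\<in>G. tensor_coefficient e (T e) f (A f) p))\<^sup>2) \<partial>(\<mu> \<Otimes>\<^sub>M \<mu>))
    = ennreal ((\<Sum>e\<in>G. (norm (T e))\<^sup>2) * (\<Sum>f\<in>F. (norm (A f))\<^sup>2))"
proof -
  define c where "c = (\<lambda>(f, e). tensor_coefficient e (T e) f (A f))"
  define h where "h p = (\<Sum>i\<in>F \<times> G. c i p)" for p
  have h: "(\<Sum>f\<in>F. \<Sum>e\<in>G. tensor_coefficient e (T e) f (A f) p) = h p" for p
    unfolding h_def sum.cartesian_product c_def by (simp add: case_prod_unfold)
  have expand: "cnj (h p) * h p = (\<Sum>i\<in>F \<times> G. \<Sum>j\<in>F \<times> G. cnj (c i p) * c j p)" for p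
    by (simp add: h_def sum_product)
  have int: "integrable (\<mu> \<Otimes>\<^sub>M \<mu>) (\<lambda>p. cnj (c i p) * c j p)" for i j
    by (cases i; cases j) (simp add: c_def tensor_coefficient_orthogonality)
  have orth: "(LINT p|(\<mu> \<Otimes>\<^sub>M \<mu>). cnj (c i p) * c j p)
      = (if i = j then complex_of_real ((norm (A (fst i)))\<^sup>2 * (norm (T (snd i)))\<^sup>2) else 0)"
    if ij: "i \<in> F \<times> G" "j \<in> F \<times> G" for i j
  proof -
    obtain f e f' e' where [simp]: "i = (f, e)" "j = (f', e')" by (metis prod.exhaust)
    have mem: "f \<in> E" "f' \<in> E" "e \<in> E" "e' \<in> E" using ij F(2) G(2) by auto
    show ?thesis
      using orthonormal_basis_cinner[OF E mem(2,1)] orthonormal_basis_cinner[OF E mem(3,4)]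
      by (auto simp: c_def tensor_coefficient_orthogonality cinner_self)
  qed
  \<comment> \<open>Orthogonality concerns complex integrals; this identity carries it over to the
    real integral of the squared modulus.\<close>
  have hh: "complex_of_real ((cmod (h p))\<^sup>2) = cnj (h p) * h p" for p
    unfolding complex_norm_square by (rule mult.commute)
  have int_h: "integrable (\<mu> \<Otimes>\<^sub>M \<mu>) (\<lambda>p. cnj (h p) * h p)"
    unfolding expand by (intro Bochner_Integration.integrable_sum int)
  have "(LINT p|(\<mu> \<Otimes>\<^sub>M \<mu>). cnj (h p) * h p)
      = (\<Sum>i\<in>F \<times> G. \<Sum>j\<in>F \<times> G. LINT p|(\<mu> \<Otimes>\<^sub>M \<mu>). cnj (c i p) * c j p)"
    unfolding expand
    by (subst Bochner_Integration.integral_sum, intro Bochner_Integration.integrable_sum int,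
        subst Bochner_Integration.integral_sum, rule int, rule refl)
  also have "\<dots> = (\<Sum>i\<in>F \<times> G. complex_of_real ((norm (A (fst i)))\<^sup>2 * (norm (T (snd i)))\<^sup>2))"
    using F(1) G(1) by (intro sum.cong refl) (simp add: orth cong: sum.cong)
  also have "\<dots> = complex_of_real ((\<Sum>e\<in>G. (norm (T e))\<^sup>2) * (\<Sum>f\<in>F. (norm (A f))\<^sup>2))"
    unfolding of_real_sum[symmetric] of_real_eq_iff
    by (subst mult.commute) (simp add: sum_product sum.cartesian_product case_prod_unfold)
  finally have lint: "(LINT p|(\<mu> \<Otimes>\<^sub>M \<mu>). (cmod (h p))\<^sup>2)
      = (\<Sum>e\<in>G. (norm (T e))\<^sup>2) * (\<Sum>f\<in>F. (norm (A f))\<^sup>2)"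
    unfolding hh[symmetric] integral_complex_of_real of_real_eq_iff .
  have "integrable (\<mu> \<Otimes>\<^sub>M \<mu>) (\<lambda>p. (cmod (h p))\<^sup>2)"
    using int_h unfolding hh[symmetric] complex_of_real_integrable_eq .
  then show ?thesis unfolding h lint[symmetric] by (intro nn_integral_eq_integral) auto
qed

section \<open>The frame transform: additivity, rank one values, square integrability\<close>

lemma op_orbit_hilbert_schmidt:
  assumes "T \<in> hilbert_schmidt"
  shows "op_orbit U T p \<in> hilbert_schmidt" "hs_norm (op_orbit U T p) = hs_norm T"
  using unitary_conjugate_hilbert_schmidt[OF unitary unitary assms]
  by (simp_all add: op_orbit_def case_prod_unfold)

text \<open>Translation preserves the Hilbert-Schmidt norm, so Cauchy-Schwarz is uniform in
  \<open>p\<close>; this drives the pointwise convergence of approximations.\<close>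

lemma frame_transform_bound:
  assumes "T \<in> hilbert_schmidt" "A \<in> hilbert_schmidt"
  shows "cmod (frame_transform U T A p) \<le> hs_norm T * hs_norm A"
  using hs_Cauchy_Schwarz[OF op_orbit_hilbert_schmidt(1)[OF assms(1)] assms(2), of p]
  by (simp add: frame_transform_def op_orbit_hilbert_schmidt(2)[OF assms(1)])

lemma frame_transform_add_right:
  assumes "T \<in> hilbert_schmidt" "A \<in> hilbert_schmidt" "B \<in> hilbert_schmidt"
  shows "frame_transform U T (\<lambda>x. A x + B x) p = frame_transform U T A p + frame_transform U T B p"
  unfolding frame_transform_def by (intro hs_inner_add_right op_orbit_hilbert_schmidt assms)

lemma frame_transform_scaleC_right:
  assumes "T \<in> hilbert_schmidt" "A \<in> hilbert_schmidt"
  shows "frame_transform U T (\<lambda>x. scaleC c (A x)) p = c * frame_transform U T A p"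
  unfolding frame_transform_def by (intro hs_inner_scaleC_right op_orbit_hilbert_schmidt assms)

lemma frame_transform_add_left:
  assumes "T \<in> hilbert_schmidt" "S \<in> hilbert_schmidt" "A \<in> hilbert_schmidt"
  shows "frame_transform U (\<lambda>x. T x + S x) A p = frame_transform U T A p + frame_transform U S A p"
proof -
  have "op_orbit U (\<lambda>x. T x + S x) p = (\<lambda>x. op_orbit U T p x + op_orbit U S p x)"
    by (simp add: op_orbit_def case_prod_unfold o_def bounded_clinearD(1)[OF unitary_opD(3)[OF unitary]])
  then show ?thesis
    unfolding frame_transform_def
    by (simp add: hs_inner_add_left[OF op_orbit_hilbert_schmidt(1) op_orbit_hilbert_schmidt(1)] assms)
qed

text \<open>The scalar product with the second operator only looks at the value of the translate at
  \<open>f\<close>, which is a multiple of \<open>U (fst p) t\<close>.\<close>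

lemma frame_transform_rank_one:
  assumes E: "orthonormal_basis (trace_basis :: 'h set)" and f: "f \<in> trace_basis"
  shows "frame_transform U (\<lambda>x. scaleC (cinner e x) t) (\<lambda>x. scaleC (cinner f x) a) p
    = tensor_coefficient e t f a p"
proof -
  note V = unitary_opD(3)[OF unitary]
  have "op_orbit U (\<lambda>x. scaleC (cinner e x) t) p f
      = scaleC (cinner (U (snd p) e) f) (U (fst p) t)"
    by (simp add: op_orbit_def case_prod_unfold bounded_clinearD(2)[OF V] cinner_cadjoint_right[OF V])
  then show ?thesis
    unfolding frame_transform_def
      hs_inner_rank_one[OF op_orbit_hilbert_schmidt(1)[OF hilbert_schmidt_rank_one[OF E]] f]
    by (simp add: cinner_scaleC_left tensor_coefficient_def flip: cinner_commute)
qed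

lemma frame_transform_restrict_op:
  assumes E: "orthonormal_basis (trace_basis :: 'h set)"
    and F: "finite F" "F \<subseteq> trace_basis" and G: "finite G"
  shows "frame_transform U (restrict_op T G) (restrict_op A F) p
    = (\<Sum>f\<in>F. \<Sum>e\<in>G. tensor_coefficient e (T e) f (A f) p)"
proof -
  note rank_one = hilbert_schmidt_rank_one[OF E]
  note restr = restrict_op_hilbert_schmidt[OF E]
  \<comment> \<open>Additivity with two zero summands reads z = z + z.\<close>
  have zero: "frame_transform U (\<lambda>x. 0) X p = 0" "frame_transform U X (\<lambda>x. 0) p = 0"
    if "X \<in> hilbert_schmidt" for X
    using frame_transform_add_left[of "\<lambda>x. 0" "\<lambda>x. 0" X p] that hilbert_schmidt_zero[OF E]
      frame_transform_add_right[of X "\<lambda>x. 0" "\<lambda>x. 0" p] by simp_all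
  have left: "frame_transform U (restrict_op T G) (\<lambda>x. scaleC (cinner f x) a) p
      = (\<Sum>e\<in>G. tensor_coefficient e (T e) f a p)" if f: "f \<in> trace_basis" for f a
    using G
  proof (induction G)
    case empty
    then show ?case using zero(1)[OF rank_one] by (simp add: restrict_op_def)
  next
    case (insert e G)
    then show ?case
      by (simp add: restrict_op_insert frame_transform_add_left rank_one restr
          frame_transform_rank_one[OF E f])
  qed
  show ?thesis
    using F
  proof (induction F)
    case empty
    then show ?case using zero(2)[OF restr[OF G]] by (simp add: restrict_op_def)
  next
    case (insert f F)
    then show ?case
      by (simp add: restrict_op_insert frame_transform_add_right rank_one restr G left)
  qed
qed

text \<open>One sequence serves two purposes: its pointwise limit gives measurability, and its
  uniform L2 bound is the input for Fatou.\<close>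

lemma frame_transform_approximation:
  assumes T: "T \<in> hilbert_schmidt" and A: "A \<in> hilbert_schmidt"
  obtains h where "\<And>n. h n \<in> borel_measurable (\<mu> \<Otimes>\<^sub>M \<mu>)"
    and "\<And>p. (\<lambda>n. h n p) \<longlonglongrightarrow> frame_transform U T A p"
    and "\<And>n. (\<integral>\<^sup>+p. ennreal ((cmod (h n p))\<^sup>2) \<partial>(\<mu> \<Otimes>\<^sub>M \<mu>)) \<le> ennreal ((hs_norm T * hs_norm A)\<^sup>2)"
proof -
  note E = orthonormal_trace_basis[OF T]
  \<comment> \<open>Finite sets are picked at accuracy \<open>1 / Suc n\<close> because both uses
    need a sequence, while summation over a basis is a limit along the directed family of finite
    subsets.\<close>
  have ex: "\<exists>F. finite F \<and> F \<subseteq> trace_basis \<and>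
      hs_norm (\<lambda>x. X x - restrict_op X F x) \<le> 1 / Suc n"
    if "X \<in> hilbert_schmidt" for X :: "'h \<Rightarrow> 'h" and n
    using restrict_op_approx[OF that E, of "1 / Suc n"] by auto
  obtain G where G: "\<And>n. finite (G n)" "\<And>n. G n \<subseteq> trace_basis"
      "\<And>n. hs_norm (\<lambda>x. T x - restrict_op T (G n) x) \<le> 1 / Suc n"
    using ex[OF T] by metis
  obtain F where F: "\<And>n. finite (F n)" "\<And>n. F n \<subseteq> trace_basis"
      "\<And>n. hs_norm (\<lambda>x. A x - restrict_op A (F n) x) \<le> 1 / Suc n"
    using ex[OF A] by metis
  define h where "h n = frame_transform U (restrict_op T (G n)) (restrict_op A (F n))" for n
  have h_sum: "h n = (\<lambda>p. \<Sum>f\<in>F n. \<Sum>e\<in>G n. tensor_coefficient e (T e) f (A f) p)" for n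
    unfolding h_def by (rule ext) (rule frame_transform_restrict_op[OF E F(1,2) G(1)])
  show thesis
  proof
    show "h n \<in> borel_measurable (\<mu> \<Otimes>\<^sub>M \<mu>)" for n unfolding h_sum by measurable
    show "(\<integral>\<^sup>+p. ennreal ((cmod (h n p))\<^sup>2) \<partial>(\<mu> \<Otimes>\<^sub>M \<mu>)) \<le> ennreal ((hs_norm T * hs_norm A)\<^sup>2)" for n
    proof -
      have "(\<Sum>e\<in>G n. (norm (T e))\<^sup>2) \<le> (hs_norm T)\<^sup>2"
        by (rule finite_sum_le_has_sum[OF hs_norm_has_sum[OF T E] G(1,2)]) simp
      moreover have "(\<Sum>f\<in>F n. (norm (A f))\<^sup>2) \<le> (hs_norm A)\<^sup>2"
        by (rule finite_sum_le_has_sum[OF hs_norm_has_sum[OF A E] F(1,2)]) simp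
      ultimately show ?thesis
        unfolding h_sum nn_integral_tensor_coefficient_sum[OF E F(1,2) G(1,2)] power_mult_distrib
        by (intro ennreal_leI mult_mono) (simp_all add: sum_nonneg)
    qed
    show "(\<lambda>n. h n p) \<longlonglongrightarrow> frame_transform U T A p" for p
    proof (rule Lim_null_comparison[THEN Lim_null[THEN iffD2]])
      show "\<forall>\<^sub>F n in sequentially. norm (h n p - frame_transform U T A p)
          \<le> (hs_norm T + hs_norm A) * (1 / Suc n)"
      proof (rule always_eventually, rule allI)
        fix n
        let ?T = "restrict_op T (G n)" and ?A = "restrict_op A (F n)"
        let ?T' = "\<lambda>x. T x - ?T x" and ?A' = "\<lambda>x. A x - ?A x"
        have R: "?T \<in> hilbert_schmidt" "?A \<in> hilbert_schmidt"
          using restrict_op_hilbert_schmidt[OF E] F(1) G(1) by blast+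
        have R': "?T' \<in> hilbert_schmidt" "?A' \<in> hilbert_schmidt"
          using hilbert_schmidt_diff T A R by blast+
        \<comment> \<open>The arguments are replaced one at a time; in the second error term
          \<open>?A\<close> remains, whose norm is at most that of \<open>A\<close>.\<close>
        have "frame_transform U T A p = frame_transform U T (\<lambda>x. ?A' x + ?A x) p" by simp
        also have "\<dots> = frame_transform U T ?A' p + frame_transform U (\<lambda>x. ?T' x + ?T x) ?A p"
          unfolding frame_transform_add_right[OF T R'(2) R(2)] by simp
        also have "\<dots> = frame_transform U T ?A' p + (frame_transform U ?T' ?A p + h n p)"
          unfolding frame_transform_add_left[OF R'(1) R(1) R(2)] h_def ..
        finally have "frame_transform U T A p - h n p
            = frame_transform U T ?A' p + frame_transform U ?T' ?A p"
          by simp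
        then have "norm (h n p - frame_transform U T A p)
            = cmod (frame_transform U T ?A' p + frame_transform U ?T' ?A p)"
          by (metis norm_minus_commute)
        also have "\<dots> \<le> hs_norm T * hs_norm ?A' + hs_norm ?T' * hs_norm ?A"
          by (rule order_trans[OF norm_triangle_ineq add_mono]; rule frame_transform_bound;
              rule T R R')
        also have "\<dots> \<le> hs_norm T * (1 / Suc n) + (1 / Suc n) * hs_norm A"
          using F(3)[of n] G(3)[of n] hs_norm_restrict_op(3)[OF A E F(1,2)]
          by (intro add_mono mult_mono) (use hs_norm_nonneg T R R' in auto)
        finally show "norm (h n p - frame_transform U T A p) \<le> (hs_norm T + hs_norm A) * (1 / Suc n)"
          by (simp only: distrib_right mult.commute)
      qed
      show "(\<lambda>n. (hs_norm T + hs_norm A) * (1 / Suc n)) \<longlonglongrightarrow> 0"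
        by (rule tendsto_mult_right_zero) (rule LIMSEQ_Suc[OF lim_1_over_n])
    qed
  qed
qed

lemma frame_transform_measurable:
  assumes "T \<in> hilbert_schmidt" "A \<in> hilbert_schmidt"
  shows "frame_transform U T A \<in> borel_measurable (\<mu> \<Otimes>\<^sub>M \<mu>)"
proof -
  obtain h where "\<And>n. h n \<in> borel_measurable (\<mu> \<Otimes>\<^sub>M \<mu>)"
    and "\<And>p. (\<lambda>n. h n p) \<longlonglongrightarrow> frame_transform U T A p"
    using frame_transform_approximation[OF assms] by metis
  then show ?thesis by (rule borel_measurable_LIMSEQ_metric)
qed

lemma frame_transform_L2_bound:
  assumes "T \<in> hilbert_schmidt" "A \<in> hilbert_schmidt"
  shows "(\<integral>\<^sup>+p. ennreal ((cmod (frame_transform U T A p))\<^sup>2) \<partial>(\<mu> \<Otimes>\<^sub>M \<mu>))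
    \<le> ennreal ((hs_norm T * hs_norm A)\<^sup>2)"
proof -
  obtain h where meas [measurable]: "\<And>n. h n \<in> borel_measurable (\<mu> \<Otimes>\<^sub>M \<mu>)"
    and lim: "\<And>p. (\<lambda>n. h n p) \<longlonglongrightarrow> frame_transform U T A p"
    and bound: "\<And>n. (\<integral>\<^sup>+p. ennreal ((cmod (h n p))\<^sup>2) \<partial>(\<mu> \<Otimes>\<^sub>M \<mu>))
      \<le> ennreal ((hs_norm T * hs_norm A)\<^sup>2)"
    using frame_transform_approximation[OF assms] by metis
  have "(\<lambda>n. ennreal ((cmod (h n p))\<^sup>2)) \<longlonglongrightarrow> ennreal ((cmod (frame_transform U T A p))\<^sup>2)" for p
    by (intro tendsto_intros lim)
  then have "ennreal ((cmod (frame_transform U T A p))\<^sup>2) = liminf (\<lambda>n. ennreal ((cmod (h n p))\<^sup>2))" for p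
    using lim_imp_Liminf[of sequentially] by (metis sequentially_bot)
  then have "(\<integral>\<^sup>+p. ennreal ((cmod (frame_transform U T A p))\<^sup>2) \<partial>(\<mu> \<Otimes>\<^sub>M \<mu>))
      = (\<integral>\<^sup>+p. liminf (\<lambda>n. ennreal ((cmod (h n p))\<^sup>2)) \<partial>(\<mu> \<Otimes>\<^sub>M \<mu>))"
    by simp
  also have "\<dots> \<le> liminf (\<lambda>n. \<integral>\<^sup>+p. ennreal ((cmod (h n p))\<^sup>2) \<partial>(\<mu> \<Otimes>\<^sub>M \<mu>))"
    by (rule nn_integral_liminf) measurable
  also have "\<dots> \<le> ennreal ((hs_norm T * hs_norm A)\<^sup>2)"
    using bound by (intro Liminf_le) (auto intro: always_eventually)
  finally show ?thesis .
qed

section \<open>The orthogonality relation by density\<close>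

lemma frame_transform_product:
  assumes "T \<in> hilbert_schmidt" "A \<in> hilbert_schmidt" "S \<in> hilbert_schmidt" "B \<in> hilbert_schmidt"
  shows "integrable (\<mu> \<Otimes>\<^sub>M \<mu>) (\<lambda>p. cnj (frame_transform U T A p) * frame_transform U S B p)"
    and "cmod (LINT p|(\<mu> \<Otimes>\<^sub>M \<mu>). cnj (frame_transform U T A p) * frame_transform U S B p)
      \<le> (hs_norm T * hs_norm A) * (hs_norm S * hs_norm B)"
proof -
  note L2 = L2_product_bound[OF frame_transform_measurable[OF assms(1,2)]
      frame_transform_L2_bound[OF assms(1,2)] frame_transform_measurable[OF assms(3,4)]
      frame_transform_L2_bound[OF assms(3,4)]]
  show "integrable (\<mu> \<Otimes>\<^sub>M \<mu>) (\<lambda>p. cnj (frame_transform U T A p) * frame_transform U S B p)"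
    by (rule L2(1); intro mult_nonneg_nonneg hs_norm_nonneg assms)
  show "cmod (LINT p|(\<mu> \<Otimes>\<^sub>M \<mu>). cnj (frame_transform U T A p) * frame_transform U S B p)
      \<le> (hs_norm T * hs_norm A) * (hs_norm S * hs_norm B)"
    by (rule L2(2); intro mult_nonneg_nonneg hs_norm_nonneg assms)
qed

text \<open>With the difference of the two sides as a function, extension by density becomes the
  vanishing of an additive bounded functional in one argument at a time.\<close>

definition defect :: "('h \<Rightarrow> 'h) \<Rightarrow> ('h \<Rightarrow> 'h) \<Rightarrow> ('h \<Rightarrow> 'h) \<Rightarrow> ('h \<Rightarrow> 'h) \<Rightarrow> complex" where
  "defect T A S B = (LINT p|(\<mu> \<Otimes>\<^sub>M \<mu>). cnj (frame_transform U T A p) * frame_transform U S B p)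
    - hs_inner A B * hs_inner S T"

text \<open>Each of the two sides is at most the product of the four norms, hence the factor
  2.\<close>

lemma defect_bound:
  assumes "T \<in> hilbert_schmidt" "A \<in> hilbert_schmidt" "S \<in> hilbert_schmidt" "B \<in> hilbert_schmidt"
  shows "cmod (defect T A S B) \<le> 2 * (hs_norm T * hs_norm A * hs_norm S * hs_norm B)"
proof -
  have "cmod (hs_inner A B * hs_inner S T) \<le> (hs_norm A * hs_norm B) * (hs_norm S * hs_norm T)"
    unfolding norm_mult
    by (intro mult_mono hs_Cauchy_Schwarz mult_nonneg_nonneg hs_norm_nonneg norm_ge_zero assms)
  then show ?thesis
    unfolding defect_def
    using norm_triangle_ineq4[of "LINT p|(\<mu> \<Otimes>\<^sub>M \<mu>). cnj (frame_transform U T A p) *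
        frame_transform U S B p" "hs_inner A B * hs_inner S T"] frame_transform_product(2)[OF assms]
    by (simp add: ac_simps)
qed

text \<open>This symmetry exchanges the two pairs, so additivity has to be shown for the first pair
  only.\<close>

lemma defect_commute:
  assumes "T \<in> hilbert_schmidt" "A \<in> hilbert_schmidt" "S \<in> hilbert_schmidt" "B \<in> hilbert_schmidt"
  shows "defect T A S B = cnj (defect S B T A)"
proof -
  have "(LINT p|(\<mu> \<Otimes>\<^sub>M \<mu>). cnj (frame_transform U T A p) * frame_transform U S B p)
      = (LINT p|(\<mu> \<Otimes>\<^sub>M \<mu>). cnj (cnj (frame_transform U S B p) * frame_transform U T A p))"
    by (simp only: complex_cnj_mult complex_cnj_cnj mult.commute)
  also have "\<dots> = cnj (LINT p|(\<mu> \<Otimes>\<^sub>M \<mu>). cnj (frame_transform U S B p) * frame_transform U T A p)"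
    by (rule Bochner_Integration.integral_cnj)
  finally have "(LINT p|(\<mu> \<Otimes>\<^sub>M \<mu>). cnj (frame_transform U T A p) * frame_transform U S B p)
      = cnj (LINT p|(\<mu> \<Otimes>\<^sub>M \<mu>). cnj (frame_transform U S B p) * frame_transform U T A p)" .
  moreover have "cnj (hs_inner B A * hs_inner T S) = hs_inner A B * hs_inner S T"
    using hs_inner_commute[OF assms(2,4)] hs_inner_commute[OF assms(3,1)] by simp
  ultimately show ?thesis unfolding defect_def by simp
qed

lemma defect_add:
  assumes "T \<in> hilbert_schmidt" "A \<in> hilbert_schmidt" "S \<in> hilbert_schmidt" "B \<in> hilbert_schmidt"
    and X: "X \<in> hilbert_schmidt"
  shows "defect (\<lambda>x. T x + X x) A S B = defect T A S B + defect X A S B"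
    and "defect T (\<lambda>x. A x + X x) S B = defect T A S B + defect T X S B"
  unfolding defect_def
  by (simp_all add: frame_transform_add_left frame_transform_add_right hs_inner_add_left
      hs_inner_add_right distrib_right distrib_left assms frame_transform_product(1))

lemma defect_eq_zeroI:
  assumes "T \<in> hilbert_schmidt" "A \<in> hilbert_schmidt" "S \<in> hilbert_schmidt" "B \<in> hilbert_schmidt"
    and E: "orthonormal_basis E"
  shows "(\<And>e t. e \<in> E \<Longrightarrow> defect (\<lambda>x. scaleC (cinner e x) t) A S B = 0) \<Longrightarrow> defect T A S B = 0"
    and "(\<And>e t. e \<in> E \<Longrightarrow> defect T (\<lambda>x. scaleC (cinner e x) t) S B = 0) \<Longrightarrow> defect T A S B = 0"
proof -
  show "defect T A S B = 0" if "\<And>e t. e \<in> E \<Longrightarrow> defect (\<lambda>x. scaleC (cinner e x) t) A S B = 0"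
  proof (rule hs_functional_eq_zero[where \<Phi> = "\<lambda>X. defect X A S B", OF E _ _ that assms(1)])
    show "cmod (defect X A S B) \<le> (2 * (hs_norm A * hs_norm S * hs_norm B)) * hs_norm X"
      if "X \<in> hilbert_schmidt" for X
      using defect_bound[OF that assms(2-4)] by (simp add: ac_simps)
  qed (rule defect_add(1), (assumption | rule assms)+)
  show "defect T A S B = 0" if "\<And>e t. e \<in> E \<Longrightarrow> defect T (\<lambda>x. scaleC (cinner e x) t) S B = 0"
  proof (rule hs_functional_eq_zero[where \<Phi> = "\<lambda>X. defect T X S B", OF E _ _ that assms(2)])
    show "cmod (defect T X S B) \<le> (2 * (hs_norm T * hs_norm S * hs_norm B)) * hs_norm X"
      if "X \<in> hilbert_schmidt" for X
      using defect_bound[OF assms(1) that assms(3-4)] by (simp add: ac_simps)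
  qed (rule defect_add(2), (assumption | rule assms)+)
qed

text \<open>Both sides consist of the same four scalar products, grouped differently: the integral
  joins \<open>a\<close> with \<open>t\<close> and \<open>e\<close> with \<open>f\<close>, by group
  variable, and the right side joins \<open>a\<close> with \<open>f\<close> and \<open>e\<close>
  with \<open>t\<close>, by operator.\<close>

lemma defect_rank_one:
  assumes E: "orthonormal_basis (trace_basis :: 'h set)"
    and mem: "e \<in> trace_basis" "f \<in> trace_basis" "e' \<in> trace_basis" "f' \<in> trace_basis"
  shows "defect (\<lambda>x. scaleC (cinner e x) t) (\<lambda>x. scaleC (cinner f x) a)
    (\<lambda>x. scaleC (cinner e' x) t') (\<lambda>x. scaleC (cinner f' x) a') = 0"
proof -
  note rank_one = hilbert_schmidt_rank_one[OF E]
  show ?thesis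
    unfolding defect_def frame_transform_rank_one[OF E mem(2)] frame_transform_rank_one[OF E mem(4)]
      tensor_coefficient_orthogonality(2) hs_inner_rank_one[OF rank_one mem(4)]
      hs_inner_rank_one[OF rank_one mem(1)] cinner_scaleC_left
    by (simp add: cinner_commute[of f' f] cinner_commute[of e e'] ac_simps)
qed

theorem frame_transform_orthogonality:
  assumes "T \<in> hilbert_schmidt" "A \<in> hilbert_schmidt" "S \<in> hilbert_schmidt" "B \<in> hilbert_schmidt"
  shows "(LINT p|(\<mu> \<Otimes>\<^sub>M \<mu>). cnj (frame_transform U T A p) * frame_transform U S B p)
    = hs_inner A B * hs_inner S T"
proof -
  note E = orthonormal_trace_basis[OF assms(1)]
  note rank_one = hilbert_schmidt_rank_one[OF E]
  \<comment> \<open>The second pair stays of rank one while the first is extended to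
    \<open>T\<close> and \<open>A\<close>; conjugate symmetry then moves these to the second place
    and frees the first for extension to \<open>S\<close> and \<open>B\<close>.\<close>
  have "defect T A (\<lambda>x. scaleC (cinner e' x) t') (\<lambda>x. scaleC (cinner f' x) a') = 0"
    if "e' \<in> trace_basis" "f' \<in> trace_basis" for e' t' f' a'
    by (rule defect_eq_zeroI(1)[OF assms(1,2) rank_one rank_one E],
        rule defect_eq_zeroI(2)[OF rank_one assms(2) rank_one rank_one E],
        rule defect_rank_one[OF E _ _ that])
  then have conj: "defect (\<lambda>x. scaleC (cinner e' x) t') (\<lambda>x. scaleC (cinner f' x) a') T A = 0"
    if "e' \<in> trace_basis" "f' \<in> trace_basis" for e' t' f' a'
    using that by (subst defect_commute[OF rank_one rank_one assms(1,2)]) simp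
  have "defect S B T A = 0"
    by (rule defect_eq_zeroI(1)[OF assms(3,4,1,2) E],
        rule defect_eq_zeroI(2)[OF rank_one assms(4,1,2) E], rule conj)
  then show ?thesis
    using defect_commute[OF assms] unfolding defect_def by simp
qed

text \<open>The diagonal case \<open>S = T\<close>, \<open>B = A\<close> of the orthogonality
  relation.\<close>

lemma frame_transform_L2:
  assumes "T \<in> hilbert_schmidt" "A \<in> hilbert_schmidt"
  shows "frame_transform U T A \<in> L2_functions (\<mu> \<Otimes>\<^sub>M \<mu>)"
    and "(LINT p|(\<mu> \<Otimes>\<^sub>M \<mu>). (cmod (frame_transform U T A p))\<^sup>2) = (hs_norm T * hs_norm A)\<^sup>2"
proof -
  have eq: "complex_of_real ((cmod z)\<^sup>2) = cnj z * z" for z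
    unfolding complex_norm_square by (rule mult.commute)
  have "integrable (\<mu> \<Otimes>\<^sub>M \<mu>) (\<lambda>p. complex_of_real ((cmod (frame_transform U T A p))\<^sup>2))"
    unfolding eq by (rule frame_transform_product(1)[OF assms assms])
  then have "integrable (\<mu> \<Otimes>\<^sub>M \<mu>) (\<lambda>p. (cmod (frame_transform U T A p))\<^sup>2)"
    unfolding complex_of_real_integrable_eq .
  then show "frame_transform U T A \<in> L2_functions (\<mu> \<Otimes>\<^sub>M \<mu>)"
    using frame_transform_measurable[OF assms] by (simp add: L2_functions_def)
  have "complex_of_real (LINT p|(\<mu> \<Otimes>\<^sub>M \<mu>). (cmod (frame_transform U T A p))\<^sup>2)
      = hs_inner A A * hs_inner T T"
    unfolding integral_complex_of_real[symmetric] eq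
    by (rule frame_transform_orthogonality[OF assms assms])
  also have "\<dots> = complex_of_real ((hs_norm T * hs_norm A)\<^sup>2)"
    unfolding hs_inner_self[OF assms(1)] hs_inner_self[OF assms(2)] of_real_mult[symmetric]
    by (simp only: power_mult_distrib mult.commute)
  finally show "(LINT p|(\<mu> \<Otimes>\<^sub>M \<mu>). (cmod (frame_transform U T A p))\<^sup>2) = (hs_norm T * hs_norm A)\<^sup>2"
    unfolding of_real_eq_iff .
qed

text \<open>Second countability makes the product of the Borel sigma-algebras the Borel
  sigma-algebra of the product (\<open>borel_prod\<close>).\<close>

lemma frame_transform_borel_measurable:
  assumes "T \<in> hilbert_schmidt" "A \<in> hilbert_schmidt"
  shows "frame_transform U T A \<in> borel_measurable borel"
proof -
  have "sets (\<mu> \<Otimes>\<^sub>M \<mu>) = sets (borel :: ('g \<times> 'g) measure)"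
    using sets_pair_measure_cong[OF sets_eq_borel sets_eq_borel] unfolding borel_prod .
  then show ?thesis
    using frame_transform_measurable[OF assms] measurable_cong_sets[OF _ refl] by blast
qed

lemma op_orbit_normalized_tight_frame:
  assumes T: "T \<in> hilbert_schmidt" "hs_norm T = 1"
  shows "normalized_tight_frame hilbert_schmidt hs_inner (\<mu> \<Otimes>\<^sub>M \<mu>) (op_orbit U T)"
  unfolding normalized_tight_frame_def
proof (intro conjI ballI)
  fix A :: "'h \<Rightarrow> 'h" assume A: "A \<in> hilbert_schmidt"
  show "(\<lambda>p. hs_inner (op_orbit U T p) A) \<in> borel_measurable (\<mu> \<Otimes>\<^sub>M \<mu>)"
    using frame_transform_measurable[OF T(1) A] by (simp add: frame_transform_def)
  \<comment> \<open>The frame condition is stated with the nonnegative integral; square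
    integrability identifies it with the Bochner integral.\<close>
  have "(\<integral>\<^sup>+p. ennreal ((cmod (frame_transform U T A p))\<^sup>2) \<partial>(\<mu> \<Otimes>\<^sub>M \<mu>))
      = ennreal (LINT p|(\<mu> \<Otimes>\<^sub>M \<mu>). (cmod (frame_transform U T A p))\<^sup>2)"
    using frame_transform_L2(1)[OF T(1) A]
    by (intro nn_integral_eq_integral) (simp_all add: L2_functions_def)
  then show "(\<integral>\<^sup>+p. ennreal ((cmod (hs_inner (op_orbit U T p) A))\<^sup>2) \<partial>(\<mu> \<Otimes>\<^sub>M \<mu>))
      = ennreal (Re (hs_inner A A))"
    by (simp add: frame_transform_L2(2)[OF T(1) A] T(2) hs_inner_self[OF A])
      (simp add: frame_transform_def)
qed (rule op_orbit_hilbert_schmidt(1)[OF T(1)])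

end

theorem theorem2:
  fixes U :: "'g::{topological_group_add, t2_space, second_countable_topology}
                \<Rightarrow> 'h::chilbert_space \<Rightarrow> 'h"
    and \<mu> :: "'g measure"
  assumes "locally_compact_space (euclidean :: 'g topology)"
    and "unimodular TYPE('g)"
    and "separable_space (euclidean :: 'h topology)"
    and "haar_measure \<mu>"
    and "square_integrable_rep \<mu> U"
    and "normalized_in_agreement \<mu> U"
  shows
    "(\<forall>A\<in>hilbert_schmidt. \<forall>T\<in>hilbert_schmidt.
        frame_transform U T A \<in> borel_measurable borel \<and>
        frame_transform U T A \<in> L2_functions (\<mu> \<Otimes>\<^sub>M \<mu>)) \<and>
     (\<forall>T\<in>hilbert_schmidt. T \<noteq> (\<lambda>x. 0) \<and> hs_norm T = 1 \<longrightarrow>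
        (\<forall>A\<in>hilbert_schmidt. \<forall>B\<in>hilbert_schmidt. \<forall>a b.
           frame_transform U T (\<lambda>x. scaleC a (A x) + scaleC b (B x)) =
           (\<lambda>p. a * frame_transform U T A p + b * frame_transform U T B p)) \<and>
        (\<forall>A\<in>hilbert_schmidt. L2_norm (\<mu> \<Otimes>\<^sub>M \<mu>) (frame_transform U T A) = hs_norm A) \<and>
        normalized_tight_frame hilbert_schmidt hs_inner (\<mu> \<Otimes>\<^sub>M \<mu>) (op_orbit U T)) \<and>
     (\<forall>A\<in>hilbert_schmidt. \<forall>B\<in>hilbert_schmidt. \<forall>S\<in>hilbert_schmidt. \<forall>T\<in>hilbert_schmidt.
        (LINT p|(\<mu> \<Otimes>\<^sub>M \<mu>). cnj (frame_transform U T A p) * frame_transform U S B p) =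
        hs_inner A B * hs_inner S T)"
proof -
  interpret sigma_finite_measure \<mu> by (rule sigma_finite_haar_measure) fact+
  interpret orthogonal_coefficients \<mu> U
  proof
    show "sets \<mu> = sets borel" using assms(4) by (simp add: haar_measure_def)
    show "unitary_op (U g)" for g
      using assms(5) by (simp add: square_integrable_rep_def projective_representation_def)
    show "(\<lambda>g. cinner \<phi> (U g \<psi>)) \<in> borel_measurable borel" for \<phi> \<psi>
      using assms(5) by (simp add: square_integrable_rep_def projective_representation_def)
    \<comment> \<open>Normalization in agreement with \<open>U\<close> means \<open>d = 1\<close>,
      so the Duflo-Moore factor disappears.\<close>
    show "(LINT g|\<mu>. cinner \<phi>1 (U g \<psi>1) * cinner (U g \<psi>2) \<phi>2) = cinner \<phi>1 \<phi>2 * cinner \<psi>2 \<psi>1"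
      for \<phi>1 \<phi>2 \<psi>1 \<psi>2
      using assms(6) by (simp add: normalized_in_agreement_def duflo_moore_number_def)
  qed
  show ?thesis
  proof (intro conjI ballI impI allI; (elim conjE)?)
    fix T A B :: "'h \<Rightarrow> 'h" and a b
    assume "T \<in> hilbert_schmidt" "A \<in> hilbert_schmidt" "B \<in> hilbert_schmidt"
    then show "frame_transform U T (\<lambda>x. scaleC a (A x) + scaleC b (B x)) =
        (\<lambda>p. a * frame_transform U T A p + b * frame_transform U T B p)"
      by (intro ext)
        (simp add: frame_transform_add_right frame_transform_scaleC_right hilbert_schmidt_scaleC)
  next
    fix T A :: "'h \<Rightarrow> 'h"
    assume "T \<in> hilbert_schmidt" "hs_norm T = 1" "A \<in> hilbert_schmidt"
    then show "L2_norm (\<mu> \<Otimes>\<^sub>M \<mu>) (frame_transform U T A) = hs_norm A"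
      by (simp add: L2_norm_def frame_transform_L2 hs_norm_nonneg)
  qed (assumption | rule frame_transform_borel_measurable frame_transform_L2(1)
      op_orbit_normalized_tight_frame frame_transform_orthogonality)+
qed

end
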